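(* Let $\mathcal{C}$ be a small preadditive category with a nonzero object. The category $\mathcal{C}$ is semilocal if and only if the $\mathcal{C}_0\times\mathcal{C}_0$-graded ring $R_{\mathcal{C}}$ is gr-semilocal.
   Context: A preadditive category is one whose morphism sets are abelian groups with bilinear composition. A semilocal category is a preadditive category with a nonzero object such that the endomorphism ring of every nonzero object is a semilocal ring (a unital ring whose quotient by its Jacobson radical is semisimple). For a set $X$, $X\times X$ is a groupoid: $(z,w)(y,x)$ is defined iff $w=y$, and then $(z,y)(y,x)=(z,x)$. For a small preadditive category $\mathcal{C}$ with set of objects $\mathcal{C}_0$ and morphism groups $\mathcal{C}(X,Y)$ (morphisms $X\to Y$), the ring $R_{\mathcal{C}}:=\bigoplus_{X,Y\in\mathcal{C}_0}\mathcal{C}(X,Y)$ has product $fg:=f\circ g$ if composable and $0$ otherwise (extended bilinearly). It is graded by $\mathcal{C}_0\times\mathcal{C}_0$ via $(R_{\mathcal{C}})_{(X,Y)}:=\mathcal{C}(Y,X)$. For a ring $R=\bigoplus_{\gamma\in\Gamma}R_\gamma$ graded by a groupoid $\Gamma$: a graded right ideal is a right ideal $U$ with $U=\bigoplus_\gamma(U\cap R_\gamma)$. It is gr-simple if it is nonzero and contains no graded right ideals other than $0$ and itself; it is gr-maximal if it is maximal among proper graded right ideals. $R$ is gr-semisimple if it is a sum of gr-simple graded right ideals. $\mathrm{rad}^{\mathrm{gr}}(R)$ is the intersection of all gr-maximal graded right ideals of $R$ ($:=R$ if there are none); for the rings considered here it is a graded two-sided ideal. $R$ is gr-semilocal if the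 graded ring $R/\mathrm{rad}^{\mathrm{gr}}(R)$ is gr-semisimple. *)

theory Defs
  imports "HOL-Algebra.Free_Abelian_Groups" "HOL-Algebra.QuotRing"
begin

section \<open>Rings, right ideals, semilocal rings\<close>

text \<open>
  Rings without unit are carried by the record type \<^type>\<open>ring\<close>; the field \<^const>\<open>one\<close> is then
  meaningless and is never referred to. The quotient \<^const>\<open>FactRing\<close> is used for such
  records as well (its carrier, addition and multiplication do not involve the unit).
\<close>

locale nonunital_ring = abelian_group R for R (structure) +
  assumes m_closed: "\<lbrakk>x \<in> carrier R; y \<in> carrier R\<rbrakk> \<Longrightarrow> x \<otimes> y \<in> carrier R"
    and m_assoc: "\<lbrakk>x \<in> carrier R; y \<in> carrier R; z \<in> carrier R\<rbrakk>
                    \<Longrightarrow> (x \<otimes> y) \<otimes> z = x \<otimes> (y \<otimes> z)"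
    and l_distr: "\<lbrakk>x \<in> carrier R; y \<in> carrier R; z \<in> carrier R\<rbrakk>
                    \<Longrightarrow> (x \<oplus> y) \<otimes> z = x \<otimes> z \<oplus> y \<otimes> z"
    and r_distr: "\<lbrakk>x \<in> carrier R; y \<in> carrier R; z \<in> carrier R\<rbrakk>
                    \<Longrightarrow> z \<otimes> (x \<oplus> y) = z \<otimes> x \<oplus> z \<otimes> y"

definition right_ideal :: "('a, 'b) ring_scheme \<Rightarrow> 'a set \<Rightarrow> bool" where
  "right_ideal R U \<longleftrightarrow>
     additive_subgroup U R \<and> (\<forall>u\<in>U. \<forall>r\<in>carrier R. u \<otimes>\<^bsub>R\<^esub> r \<in> U)"

text \<open>The sum of a (possibly infinite) set of right ideals; the empty sum is zero.\<close>

definition ideal_sum :: "('a, 'b) ring_scheme \<Rightarrow> 'a set set \<Rightarrow> 'a set" where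
  "ideal_sum R F = generate (add_monoid R) (\<Union>F)"

definition maximal_right_ideal :: "('a, 'b) ring_scheme \<Rightarrow> 'a set \<Rightarrow> bool" where
  "maximal_right_ideal R M \<longleftrightarrow>
     right_ideal R M \<and> M \<noteq> carrier R \<and>
     (\<forall>U. right_ideal R U \<and> M \<subseteq> U \<and> U \<noteq> carrier R \<longrightarrow> U = M)"

definition simple_right_ideal :: "('a, 'b) ring_scheme \<Rightarrow> 'a set \<Rightarrow> bool" where
  "simple_right_ideal R U \<longleftrightarrow>
     right_ideal R U \<and> U \<noteq> {\<zero>\<^bsub>R\<^esub>} \<and>
     (\<forall>V. right_ideal R V \<and> V \<subseteq> U \<longrightarrow> V = {\<zero>\<^bsub>R\<^esub>} \<or> V = U)"

definition jacobson_radical :: "('a, 'b) ring_scheme \<Rightarrow> 'a set" where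
  "jacobson_radical R = carrier R \<inter> \<Inter>{M. maximal_right_ideal R M}"

definition semisimple_ring :: "('a, 'b) ring_scheme \<Rightarrow> bool" where
  "semisimple_ring R \<longleftrightarrow>
     ring R \<and> (\<exists>F. (\<forall>U\<in>F. simple_right_ideal R U) \<and> carrier R = ideal_sum R F)"

definition semilocal_ring :: "('a, 'b) ring_scheme \<Rightarrow> bool" where
  "semilocal_ring R \<longleftrightarrow> ring R \<and> semisimple_ring (R Quot (jacobson_radical R))"


section \<open>Groupoids and groupoid graded rings\<close>

record ('x, 'g) gpd =
  Gobj :: "'x set"
  Garr :: "'g set"
  Gsrc :: "'g \<Rightarrow> 'x"
  Gtgt :: "'g \<Rightarrow> 'x"
  Gmul :: "'g \<Rightarrow> 'g \<Rightarrow> 'g"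
  Gid :: "'x \<Rightarrow> 'g"

text \<open>The product \<open>g h\<close> is regarded as defined iff \<open>Gsrc g = Gtgt h\<close>; other values of
  \<open>Gmul\<close> are irrelevant.\<close>

locale groupoid =
  fixes \<Gamma> :: "('x, 'g) gpd"
  assumes src_closed: "g \<in> Garr \<Gamma> \<Longrightarrow> Gsrc \<Gamma> g \<in> Gobj \<Gamma>"
    and tgt_closed: "g \<in> Garr \<Gamma> \<Longrightarrow> Gtgt \<Gamma> g \<in> Gobj \<Gamma>"
    and id_closed: "x \<in> Gobj \<Gamma> \<Longrightarrow> Gid \<Gamma> x \<in> Garr \<Gamma>"
    and id_src: "x \<in> Gobj \<Gamma> \<Longrightarrow> Gsrc \<Gamma> (Gid \<Gamma> x) = x"
    and id_tgt: "x \<in> Gobj \<Gamma> \<Longrightarrow> Gtgt \<Gamma> (Gid \<Gamma> x) = x"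
    and mul_closed: "\<lbrakk>g \<in> Garr \<Gamma>; h \<in> Garr \<Gamma>; Gsrc \<Gamma> g = Gtgt \<Gamma> h\<rbrakk> \<Longrightarrow> Gmul \<Gamma> g h \<in> Garr \<Gamma>"
    and mul_src: "\<lbrakk>g \<in> Garr \<Gamma>; h \<in> Garr \<Gamma>; Gsrc \<Gamma> g = Gtgt \<Gamma> h\<rbrakk>
                    \<Longrightarrow> Gsrc \<Gamma> (Gmul \<Gamma> g h) = Gsrc \<Gamma> h"
    and mul_tgt: "\<lbrakk>g \<in> Garr \<Gamma>; h \<in> Garr \<Gamma>; Gsrc \<Gamma> g = Gtgt \<Gamma> h\<rbrakk>
                    \<Longrightarrow> Gtgt \<Gamma> (Gmul \<Gamma> g h) = Gtgt \<Gamma> g"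
    and mul_assoc: "\<lbrakk>g \<in> Garr \<Gamma>; h \<in> Garr \<Gamma>; k \<in> Garr \<Gamma>; Gsrc \<Gamma> g = Gtgt \<Gamma> h; Gsrc \<Gamma> h = Gtgt \<Gamma> k\<rbrakk>
                    \<Longrightarrow> Gmul \<Gamma> (Gmul \<Gamma> g h) k = Gmul \<Gamma> g (Gmul \<Gamma> h k)"
    and id_left: "g \<in> Garr \<Gamma> \<Longrightarrow> Gmul \<Gamma> (Gid \<Gamma> (Gtgt \<Gamma> g)) g = g"
    and id_right: "g \<in> Garr \<Gamma> \<Longrightarrow> Gmul \<Gamma> g (Gid \<Gamma> (Gsrc \<Gamma> g)) = g"
    and inverse: "g \<in> Garr \<Gamma> \<Longrightarrow> \<exists>h\<in>Garr \<Gamma>. Gsrc \<Gamma> h = Gtgt \<Gamma> g \<and> Gtgt \<Gamma> h = Gsrc \<Gamma> g \<and>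
                    Gmul \<Gamma> g h = Gid \<Gamma> (Gtgt \<Gamma> g) \<and> Gmul \<Gamma> h g = Gid \<Gamma> (Gsrc \<Gamma> g)"

text \<open>The groupoid \<open>X \<times> X\<close>: \<open>(z, w)(y, x)\<close> is defined iff \<open>w = y\<close>, with value \<open>(z, x)\<close>.\<close>

definition pair_groupoid :: "'x set \<Rightarrow> ('x, 'x \<times> 'x) gpd" where
  "pair_groupoid X =
     \<lparr>Gobj = X, Garr = X \<times> X, Gsrc = snd, Gtgt = fst,
      Gmul = (\<lambda>g h. (fst g, snd h)), Gid = (\<lambda>x. (x, x))\<rparr>"

definition internal_direct_sum ::
    "('a, 'b) ring_scheme \<Rightarrow> 'i set \<Rightarrow> ('i \<Rightarrow> 'a set) \<Rightarrow> 'a set \<Rightarrow> bool" where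
  "internal_direct_sum R I A U \<longleftrightarrow>
     (\<forall>i\<in>I. additive_subgroup (A i) R) \<and>
     U = generate (add_monoid R) (\<Union>i\<in>I. A i) \<and>
     (\<forall>J x. finite J \<and> J \<subseteq> I \<and> x \<in> (\<Pi> i\<in>J. A i) \<and> finsum R x J = \<zero>\<^bsub>R\<^esub>
        \<longrightarrow> (\<forall>i\<in>J. x i = \<zero>\<^bsub>R\<^esub>))"

text \<open>\<open>A \<gamma>\<close> is the homogeneous component of degree \<open>\<gamma>\<close>.\<close>

locale graded_ring = groupoid \<Gamma> + nonunital_ring R
  for \<Gamma> :: "('x, 'g) gpd" and R :: "('a, 'b) ring_scheme" (structure)
    and A :: "'g \<Rightarrow> 'a set" +
  assumes direct_sum: "internal_direct_sum R (Garr \<Gamma>) A (carrier R)"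
    and grade_mult: "\<lbrakk>g \<in> Garr \<Gamma>; h \<in> Garr \<Gamma>; a \<in> A g; b \<in> A h; Gsrc \<Gamma> g = Gtgt \<Gamma> h\<rbrakk>
                      \<Longrightarrow> a \<otimes> b \<in> A (Gmul \<Gamma> g h)"
    and grade_mult_zero: "\<lbrakk>g \<in> Garr \<Gamma>; h \<in> Garr \<Gamma>; a \<in> A g; b \<in> A h; Gsrc \<Gamma> g \<noteq> Gtgt \<Gamma> h\<rbrakk>
                      \<Longrightarrow> a \<otimes> b = \<zero>"

definition graded_right_ideal ::
    "('x, 'g) gpd \<Rightarrow> ('a, 'b) ring_scheme \<Rightarrow> ('g \<Rightarrow> 'a set) \<Rightarrow> 'a set \<Rightarrow> bool" where
  "graded_right_ideal \<Gamma> R A U \<longleftrightarrow>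
     right_ideal R U \<and> internal_direct_sum R (Garr \<Gamma>) (\<lambda>\<gamma>. U \<inter> A \<gamma>) U"

definition gr_simple ::
    "('x, 'g) gpd \<Rightarrow> ('a, 'b) ring_scheme \<Rightarrow> ('g \<Rightarrow> 'a set) \<Rightarrow> 'a set \<Rightarrow> bool" where
  "gr_simple \<Gamma> R A U \<longleftrightarrow>
     graded_right_ideal \<Gamma> R A U \<and> U \<noteq> {\<zero>\<^bsub>R\<^esub>} \<and>
     (\<forall>V. graded_right_ideal \<Gamma> R A V \<and> V \<subseteq> U \<longrightarrow> V = {\<zero>\<^bsub>R\<^esub>} \<or> V = U)"

definition gr_maximal ::
    "('x, 'g) gpd \<Rightarrow> ('a, 'b) ring_scheme \<Rightarrow> ('g \<Rightarrow> 'a set) \<Rightarrow> 'a set \<Rightarrow> bool" where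
  "gr_maximal \<Gamma> R A M \<longleftrightarrow>
     graded_right_ideal \<Gamma> R A M \<and> M \<noteq> carrier R \<and>
     (\<forall>U. graded_right_ideal \<Gamma> R A U \<and> M \<subseteq> U \<and> U \<noteq> carrier R \<longrightarrow> U = M)"

definition gr_semisimple ::
    "('x, 'g) gpd \<Rightarrow> ('a, 'b) ring_scheme \<Rightarrow> ('g \<Rightarrow> 'a set) \<Rightarrow> bool" where
  "gr_semisimple \<Gamma> R A \<longleftrightarrow>
     graded_ring \<Gamma> R A \<and>
     (\<exists>F. (\<forall>U\<in>F. gr_simple \<Gamma> R A U) \<and> carrier R = ideal_sum R F)"

text \<open>The intersection with the carrier makes this all of \<open>R\<close> if there are no gr-maximal
  graded right ideals.\<close>

definition gr_radical ::
    "('x, 'g) gpd \<Rightarrow> ('a, 'b) ring_scheme \<Rightarrow> ('g \<Rightarrow> 'a set) \<Rightarrow> 'a set" where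
  "gr_radical \<Gamma> R A = carrier R \<inter> \<Inter>{M. gr_maximal \<Gamma> R A M}"

definition quot_grade ::
    "('a, 'b) ring_scheme \<Rightarrow> 'a set \<Rightarrow> ('g \<Rightarrow> 'a set) \<Rightarrow> 'g \<Rightarrow> 'a set set" where
  "quot_grade R I A \<gamma> = (\<lambda>r. I +>\<^bsub>R\<^esub> r) ` A \<gamma>"

definition gr_semilocal ::
    "('x, 'g) gpd \<Rightarrow> ('a, 'b) ring_scheme \<Rightarrow> ('g \<Rightarrow> 'a set) \<Rightarrow> bool" where
  "gr_semilocal \<Gamma> R A \<longleftrightarrow>
     graded_ring \<Gamma> R A \<and>
     gr_semisimple \<Gamma> (R Quot (gr_radical \<Gamma> R A)) (quot_grade R (gr_radical \<Gamma> R A) A)"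


section \<open>Preadditive categories and their rings\<close>

text \<open>
  \<open>Hom C X Y\<close> is the abelian group of morphisms \<open>X \<rightarrow> Y\<close>, in the multiplicative notation of
  \<^const>\<open>comm_group\<close>: \<open>\<otimes>\<^bsub>Hom C X Y\<^esub>\<close> is the addition of morphisms and \<open>\<one>\<^bsub>Hom C X Y\<^esub>\<close> is the
  zero morphism. \<open>Comp C X Y Z g f\<close> is \<open>g \<circ> f\<close> for \<open>f : X \<rightarrow> Y\<close> and \<open>g : Y \<rightarrow> Z\<close>. The
  carriers of different morphism groups need not be disjoint.
\<close>

record ('o, 'm) precat =
  Obj :: "'o set"
  Hom :: "'o \<Rightarrow> 'o \<Rightarrow> 'm monoid"
  Comp :: "'o \<Rightarrow> 'o \<Rightarrow> 'o \<Rightarrow> 'm \<Rightarrow> 'm \<Rightarrow> 'm"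
  Idn :: "'o \<Rightarrow> 'm"

locale preadditive_category =
  fixes C :: "('o, 'm) precat"
  assumes hom_group: "\<lbrakk>X \<in> Obj C; Y \<in> Obj C\<rbrakk> \<Longrightarrow> comm_group (Hom C X Y)"
    and comp_closed: "\<lbrakk>X \<in> Obj C; Y \<in> Obj C; Z \<in> Obj C;
           f \<in> carrier (Hom C X Y); g \<in> carrier (Hom C Y Z)\<rbrakk>
           \<Longrightarrow> Comp C X Y Z g f \<in> carrier (Hom C X Z)"
    and comp_assoc: "\<lbrakk>W \<in> Obj C; X \<in> Obj C; Y \<in> Obj C; Z \<in> Obj C;
           f \<in> carrier (Hom C W X); g \<in> carrier (Hom C X Y); h \<in> carrier (Hom C Y Z)\<rbrakk>
           \<Longrightarrow> Comp C W X Z (Comp C X Y Z h g) f = Comp C W Y Z h (Comp C W X Y g f)"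
    and idn_closed: "X \<in> Obj C \<Longrightarrow> Idn C X \<in> carrier (Hom C X X)"
    and idn_left: "\<lbrakk>X \<in> Obj C; Y \<in> Obj C; f \<in> carrier (Hom C X Y)\<rbrakk>
           \<Longrightarrow> Comp C X Y Y (Idn C Y) f = f"
    and idn_right: "\<lbrakk>X \<in> Obj C; Y \<in> Obj C; f \<in> carrier (Hom C X Y)\<rbrakk>
           \<Longrightarrow> Comp C X X Y f (Idn C X) = f"
    and comp_add_left: "\<lbrakk>X \<in> Obj C; Y \<in> Obj C; Z \<in> Obj C;
           f \<in> carrier (Hom C X Y); g \<in> carrier (Hom C Y Z); g' \<in> carrier (Hom C Y Z)\<rbrakk>
           \<Longrightarrow> Comp C X Y Z (g \<otimes>\<^bsub>Hom C Y Z\<^esub> g') f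
                 = Comp C X Y Z g f \<otimes>\<^bsub>Hom C X Z\<^esub> Comp C X Y Z g' f"
    and comp_add_right: "\<lbrakk>X \<in> Obj C; Y \<in> Obj C; Z \<in> Obj C;
           f \<in> carrier (Hom C X Y); f' \<in> carrier (Hom C X Y); g \<in> carrier (Hom C Y Z)\<rbrakk>
           \<Longrightarrow> Comp C X Y Z g (f \<otimes>\<^bsub>Hom C X Y\<^esub> f')
                 = Comp C X Y Z g f \<otimes>\<^bsub>Hom C X Z\<^esub> Comp C X Y Z g f'"

text \<open>A zero object is an object that is both initial and terminal.\<close>

definition zero_object :: "('o, 'm) precat \<Rightarrow> 'o \<Rightarrow> bool" where
  "zero_object C X \<longleftrightarrow> X \<in> Obj C \<and>
     (\<forall>Y\<in>Obj C. (\<exists>!f. f \<in> carrier (Hom C X Y)) \<and> (\<exists>!f. f \<in> carrier (Hom C Y X)))"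

definition has_nonzero_object :: "('o, 'm) precat \<Rightarrow> bool" where
  "has_nonzero_object C \<longleftrightarrow> (\<exists>X\<in>Obj C. \<not> zero_object C X)"

definition end_ring :: "('o, 'm) precat \<Rightarrow> 'o \<Rightarrow> 'm ring" where
  "end_ring C X =
     \<lparr>carrier = carrier (Hom C X X), mult = Comp C X X X, one = Idn C X,
      zero = \<one>\<^bsub>Hom C X X\<^esub>, add = mult (Hom C X X)\<rparr>"

definition semilocal_category :: "('o, 'm) precat \<Rightarrow> bool" where
  "semilocal_category C \<longleftrightarrow>
     preadditive_category C \<and> has_nonzero_object C \<and>
     (\<forall>X\<in>Obj C. \<not> zero_object C X \<longrightarrow> semilocal_ring (end_ring C X))"

text \<open>
  The additive group of \<open>R\<^sub>C\<close> is the direct sum of the groups \<open>Hom C Y X\<close>, indexed by the degrees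
  \<open>(X, Y)\<close>. The bilinear extension of the composition is matrix multiplication:
  \<open>(f g)(X, Z) = \<Sum>\<^sub>Y f(X, Y) \<circ> g(Y, Z)\<close>, where all but finitely many summands vanish
  (\<^const>\<open>gfinprod\<close> is the product over the support). See \<open>category_ring_mult_homogeneous\<close>
  below for the product of homogeneous elements.
\<close>

definition category_ring_group :: "('o, 'm) precat \<Rightarrow> ('o \<times> 'o \<Rightarrow> 'm) monoid" where
  "category_ring_group C = sum_group (Obj C \<times> Obj C) (\<lambda>(X, Y). Hom C Y X)"

definition category_ring_mult ::
    "('o, 'm) precat \<Rightarrow> ('o \<times> 'o \<Rightarrow> 'm) \<Rightarrow> ('o \<times> 'o \<Rightarrow> 'm) \<Rightarrow> 'o \<times> 'o \<Rightarrow> 'm" where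
  "category_ring_mult C f g =
     (\<lambda>(X, Z)\<in>Obj C \<times> Obj C.
        gfinprod (Hom C Z X) (\<lambda>Y. Comp C Z Y X (f (X, Y)) (g (Y, Z))) (Obj C))"

definition category_ring :: "('o, 'm) precat \<Rightarrow> ('o \<times> 'o \<Rightarrow> 'm) ring" where
  "category_ring C =
     \<lparr>carrier = carrier (category_ring_group C), mult = category_ring_mult C, one = undefined,
      zero = \<one>\<^bsub>category_ring_group C\<^esub>, add = mult (category_ring_group C)\<rparr>"

text \<open>The component of degree \<open>(X, Y)\<close> is the summand \<open>Hom C Y X\<close>.\<close>

definition category_ring_grade :: "('o, 'm) precat \<Rightarrow> 'o \<times> 'o \<Rightarrow> ('o \<times> 'o \<Rightarrow> 'm) set" where
  "category_ring_grade C = (\<lambda>(X, Y).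
     {f \<in> carrier (category_ring C).
        \<forall>(X', Y')\<in>Obj C \<times> Obj C. (X', Y') \<noteq> (X, Y) \<longrightarrow> f (X', Y') = \<one>\<^bsub>Hom C Y' X'\<^esub>})"

definition homogeneous :: "('o, 'm) precat \<Rightarrow> 'o \<Rightarrow> 'o \<Rightarrow> 'm \<Rightarrow> 'o \<times> 'o \<Rightarrow> 'm" where
  "homogeneous C X Y a =
     (\<lambda>(X', Y')\<in>Obj C \<times> Obj C. if (X', Y') = (X, Y) then a else \<one>\<^bsub>Hom C Y' X'\<^esub>)"

text \<open>
  The remaining facts confirm that the data defined above are what they should be: \<open>end_ring\<close> is
  a ring, and \<open>category_ring\<close> is a ring graded by \<open>Obj C \<times> Obj C\<close>, whose product extends the
  composition of morphisms.
\<close>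

lemma hom_finprod:
  assumes "comm_group G" "comm_group H" "\<phi> \<in> hom G H" "finite S" "a \<in> S \<rightarrow> carrier G"
  shows "\<phi> (finprod G a S) = finprod H (\<lambda>i. \<phi> (a i)) S"
proof -
  interpret G: comm_group G by fact
  interpret H: comm_group H by fact
  interpret group_hom G H \<phi>
    using assms by (simp add: group_hom_def group_hom_axioms_def G.is_group H.is_group)
  show ?thesis
    using assms(4,5)
  proof (induction S rule: finite_induct)
    case (insert x F)
    have a: "a \<in> F \<rightarrow> carrier G" "a x \<in> carrier G" using insert.prems by auto
    have "(\<lambda>i. \<phi> (a i)) \<in> F \<rightarrow> carrier H" using a(1) hom_closed by blast
    with insert a show ?case by simp
  qed simp
qed

lemma finprod_swap:
  assumes "comm_group G" "finite S" "finite T"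
    and "\<And>i j. \<lbrakk>i \<in> S; j \<in> T\<rbrakk> \<Longrightarrow> a i j \<in> carrier G"
  shows "finprod G (\<lambda>i. finprod G (\<lambda>j. a i j) T) S = finprod G (\<lambda>j. finprod G (\<lambda>i. a i j) S) T"
proof -
  interpret G: comm_group G by fact
  show ?thesis
    using assms(2,4)
  proof (induction S rule: finite_induct)
    case (insert x F)
    have "finprod G (\<lambda>i. finprod G (\<lambda>j. a i j) T) (insert x F) =
        finprod G (\<lambda>j. a x j) T \<otimes>\<^bsub>G\<^esub> finprod G (\<lambda>i. finprod G (\<lambda>j. a i j) T) F"
      using insert by (subst G.finprod_insert) (auto intro!: G.finprod_closed)
    also have "\<dots> = finprod G (\<lambda>j. a x j) T \<otimes>\<^bsub>G\<^esub> finprod G (\<lambda>j. finprod G (\<lambda>i. a i j) F) T"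
      using insert by simp
    also have "\<dots> = finprod G (\<lambda>j. a x j \<otimes>\<^bsub>G\<^esub> finprod G (\<lambda>i. a i j) F) T"
      using insert by (subst G.finprod_multf) (auto intro!: G.finprod_closed)
    also have "\<dots> = finprod G (\<lambda>j. finprod G (\<lambda>i. a i j) (insert x F)) T"
    proof (rule G.finprod_cong', goal_cases)
      case 2
      show ?case using insert.prems by (auto intro!: G.finprod_closed)
    next
      case (3 j)
      have "finprod G (\<lambda>i. a i j) (insert x F) = a x j \<otimes>\<^bsub>G\<^esub> finprod G (\<lambda>i. a i j) F"
        using insert 3 by (intro G.finprod_insert) auto
      then show ?case by simp
    qed simp
    finally show ?case .
  qed simp
qed

context preadditive_category
begin

lemma hom_grp: "\<lbrakk>X \<in> Obj C; Y \<in> Obj C\<rbrakk> \<Longrightarrow> group (Hom C X Y)"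
  using hom_group comm_group.axioms(2) by blast

lemma hom_cmon: "\<lbrakk>X \<in> Obj C; Y \<in> Obj C\<rbrakk> \<Longrightarrow> comm_monoid (Hom C X Y)"
  using hom_group comm_group.axioms(1) by blast

lemma one_in: "\<lbrakk>X \<in> Obj C; Y \<in> Obj C\<rbrakk> \<Longrightarrow> \<one>\<^bsub>Hom C X Y\<^esub> \<in> carrier (Hom C X Y)"
  by (simp add: hom_grp group.is_monoid monoid.one_closed)

lemma comp_hom_left:
  assumes "X \<in> Obj C" "Y \<in> Obj C" "Z \<in> Obj C" "f \<in> carrier (Hom C X Y)"
  shows "(\<lambda>g. Comp C X Y Z g f) \<in> hom (Hom C Y Z) (Hom C X Z)"
  using assms by (auto simp: hom_def comp_closed comp_add_left)

lemma comp_hom_right: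
  assumes "X \<in> Obj C" "Y \<in> Obj C" "Z \<in> Obj C" "g \<in> carrier (Hom C Y Z)"
  shows "(\<lambda>f. Comp C X Y Z g f) \<in> hom (Hom C X Y) (Hom C X Z)"
  using assms by (auto simp: hom_def comp_closed comp_add_right)

lemma comp_zero_left:
  assumes "X \<in> Obj C" "Y \<in> Obj C" "Z \<in> Obj C" "f \<in> carrier (Hom C X Y)"
  shows "Comp C X Y Z \<one>\<^bsub>Hom C Y Z\<^esub> f = \<one>\<^bsub>Hom C X Z\<^esub>"
  using hom_one[OF comp_hom_left[OF assms]] assms by (simp add: hom_grp)

lemma comp_zero_right:
  assumes "X \<in> Obj C" "Y \<in> Obj C" "Z \<in> Obj C" "g \<in> carrier (Hom C Y Z)"
  shows "Comp C X Y Z g \<one>\<^bsub>Hom C X Y\<^esub> = \<one>\<^bsub>Hom C X Z\<^esub>"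
  using hom_one[OF comp_hom_right[OF assms]] assms by (simp add: hom_grp)

lemma end_ring_is_ring:
  assumes X: "X \<in> Obj C"
  shows "ring (end_ring C X)"
proof (rule ringI)
  interpret G: comm_group "Hom C X X" using X hom_group by blast
  show "abelian_group (end_ring C X)"
    by (rule abelian_groupI)
      (auto simp: end_ring_def G.m_assoc intro: G.m_comm G.l_inv_ex)
  show "monoid (end_ring C X)"
    by (rule monoidI)
      (use X in \<open>auto simp: end_ring_def comp_closed idn_closed comp_assoc idn_left idn_right\<close>)
qed (use X in \<open>auto simp: end_ring_def comp_add_left comp_add_right\<close>)

lemma carrier_category_ring:
  "carrier (category_ring C) =
     {f \<in> (\<Pi>\<^sub>E (X, Y)\<in>Obj C \<times> Obj C. carrier (Hom C Y X)).
        finite {p \<in> Obj C \<times> Obj C. f p \<noteq> (case p of (X, Y) \<Rightarrow> \<one>\<^bsub>Hom C Y X\<^esub>)}}"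
proof -
  have "carrier (category_ring C) =
     {f \<in> (\<Pi>\<^sub>E p\<in>Obj C \<times> Obj C. carrier (case p of (X, Y) \<Rightarrow> Hom C Y X)).
        finite {p \<in> Obj C \<times> Obj C. f p \<noteq> \<one>\<^bsub>(case p of (X, Y) \<Rightarrow> Hom C Y X)\<^esub>}}"
    unfolding category_ring_def category_ring_group_def partial_object.simps
    by (subst carrier_sum_group) (auto simp: hom_grp)
  moreover have "carrier (case p of (X, Y) \<Rightarrow> Hom C Y X) = (case p of (X, Y) \<Rightarrow> carrier (Hom C Y X))"
    and "\<one>\<^bsub>(case p of (X, Y) \<Rightarrow> Hom C Y X)\<^esub> = (case p of (X, Y) \<Rightarrow> \<one>\<^bsub>Hom C Y X\<^esub>)" for p
    by (auto split: prod.split)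
  ultimately show ?thesis by simp
qed

lemma cr_app:
  "\<lbrakk>f \<in> carrier (category_ring C); X \<in> Obj C; Y \<in> Obj C\<rbrakk> \<Longrightarrow> f (X, Y) \<in> carrier (Hom C Y X)"
  by (fastforce simp: carrier_category_ring PiE_iff)

lemma cr_ext:
  assumes "f \<in> carrier (category_ring C)" "g \<in> carrier (category_ring C)"
    and "\<And>X Y. \<lbrakk>X \<in> Obj C; Y \<in> Obj C\<rbrakk> \<Longrightarrow> f (X, Y) = g (X, Y)"
  shows "f = g"
proof (rule PiE_ext)
  show "f \<in> (\<Pi>\<^sub>E (X, Y)\<in>Obj C \<times> Obj C. carrier (Hom C Y X))"
    "g \<in> (\<Pi>\<^sub>E (X, Y)\<in>Obj C \<times> Obj C. carrier (Hom C Y X))"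
    using assms by (auto simp: carrier_category_ring)
qed (use assms in auto)

lemma cr_supp:
  assumes "f \<in> carrier (category_ring C)"
  obtains S where "finite S" "S \<subseteq> Obj C"
    "\<And>X Y. \<lbrakk>X \<in> Obj C; Y \<in> Obj C; X \<notin> S \<or> Y \<notin> S\<rbrakk> \<Longrightarrow> f (X, Y) = \<one>\<^bsub>Hom C Y X\<^esub>"
proof -
  define P where "P = {p \<in> Obj C \<times> Obj C. f p \<noteq> (case p of (X, Y) \<Rightarrow> \<one>\<^bsub>Hom C Y X\<^esub>)}"
  have "finite P" using assms by (simp add: carrier_category_ring P_def)
  have sub: "P \<subseteq> Obj C \<times> Obj C" by (auto simp: P_def)
  have z: "f (X, Y) = \<one>\<^bsub>Hom C Y X\<^esub>"
    if "X \<in> Obj C" "Y \<in> Obj C" "X \<notin> fst ` P \<union> snd ` P \<or> Y \<notin> fst ` P \<union> snd ` P" for X Y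
  proof -
    have "(X, Y) \<notin> P"
      using that(3) image_eqI[of X fst "(X, Y)" P] image_eqI[of Y snd "(X, Y)" P] by auto
    then show ?thesis using that(1,2) by (simp add: P_def)
  qed
  show ?thesis
  proof (rule that)
    show "finite (fst ` P \<union> snd ` P)" using \<open>finite P\<close> by simp
    show "fst ` P \<union> snd ` P \<subseteq> Obj C" using sub by auto
  qed (rule z)
qed

lemma cr_memI:
  assumes "f \<in> extensional (Obj C \<times> Obj C)"
    and "\<And>X Y. \<lbrakk>X \<in> Obj C; Y \<in> Obj C\<rbrakk> \<Longrightarrow> f (X, Y) \<in> carrier (Hom C Y X)"
    and "finite S"
    and "\<And>X Y. \<lbrakk>X \<in> Obj C; Y \<in> Obj C; X \<notin> S \<or> Y \<notin> S\<rbrakk> \<Longrightarrow> f (X, Y) = \<one>\<^bsub>Hom C Y X\<^esub>"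
  shows "f \<in> carrier (category_ring C)"
proof -
  have "{p \<in> Obj C \<times> Obj C. f p \<noteq> (case p of (X, Y) \<Rightarrow> \<one>\<^bsub>Hom C Y X\<^esub>)} \<subseteq> S \<times> S"
    using assms(4) by auto
  then show ?thesis
    using assms by (auto simp: carrier_category_ring PiE_iff intro: finite_subset)
qed

lemma cr_mult_app:
  assumes f: "f \<in> carrier (category_ring C)" and g: "g \<in> carrier (category_ring C)"
    and X: "X \<in> Obj C" and Z: "Z \<in> Obj C" and S: "finite S" "S \<subseteq> Obj C"
    and zero: "\<And>Y. \<lbrakk>Y \<in> Obj C; Y \<notin> S\<rbrakk> \<Longrightarrow> f (X, Y) = \<one>\<^bsub>Hom C Y X\<^esub> \<or> g (Y, Z) = \<one>\<^bsub>Hom C Z Y\<^esub>"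
  shows "(f \<otimes>\<^bsub>category_ring C\<^esub> g) (X, Z) =
           finprod (Hom C Z X) (\<lambda>Y. Comp C Z Y X (f (X, Y)) (g (Y, Z))) S"
proof -
  interpret H: comm_monoid "Hom C Z X" using hom_cmon X Z by blast
  have cl: "Comp C Z Y X (f (X, Y)) (g (Y, Z)) \<in> carrier (Hom C Z X)" if "Y \<in> Obj C" for Y
    using that f g X Z by (simp add: comp_closed cr_app)
  have 1: "Comp C Z Y X (f (X, Y)) (g (Y, Z)) = \<one>\<^bsub>Hom C Z X\<^esub>" if "Y \<in> Obj C - S" for Y
  proof -
    have "Y \<in> Obj C" "f (X, Y) \<in> carrier (Hom C Y X)" "g (Y, Z) \<in> carrier (Hom C Z Y)"
      using that f g X Z by (auto simp: cr_app)
    then show ?thesis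
      using zero[of Y] that X Z comp_zero_left comp_zero_right by fastforce
  qed
  have "gfinprod (Hom C Z X) (\<lambda>Y. Comp C Z Y X (f (X, Y)) (g (Y, Z))) (Obj C)
      = gfinprod (Hom C Z X) (\<lambda>Y. Comp C Z Y X (f (X, Y)) (g (Y, Z))) S"
    by (rule H.gfinprod_mono_neutral_cong_right) (use S cl 1 in auto)
  also have "\<dots> = finprod (Hom C Z X) (\<lambda>Y. Comp C Z Y X (f (X, Y)) (g (Y, Z))) S"
    using S cl by (intro H.gfinprod_eq_finprod) auto
  finally show ?thesis
    using X Z by (simp add: category_ring_def category_ring_mult_def)
qed

lemma cr_add_app:
  "\<lbrakk>X \<in> Obj C; Y \<in> Obj C\<rbrakk> \<Longrightarrow>
     (f \<oplus>\<^bsub>category_ring C\<^esub> g) (X, Y) = f (X, Y) \<otimes>\<^bsub>Hom C Y X\<^esub> g (X, Y)"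
  by (simp add: category_ring_def category_ring_group_def)

lemma cr_zero_app:
  "\<lbrakk>X \<in> Obj C; Y \<in> Obj C\<rbrakk> \<Longrightarrow> \<zero>\<^bsub>category_ring C\<^esub> (X, Y) = \<one>\<^bsub>Hom C Y X\<^esub>"
  by (simp add: category_ring_def category_ring_group_def)

lemma cr_abelian_group: "abelian_group (category_ring C)"
proof -
  interpret G: group "category_ring_group C"
    unfolding category_ring_group_def by (rule sum_group) (auto simp: hom_grp)
  have cl: "f \<oplus>\<^bsub>category_ring C\<^esub> g \<in> carrier (category_ring C)"
    if "f \<in> carrier (category_ring C)" "g \<in> carrier (category_ring C)" for f g
    using that by (simp add: category_ring_def)
  have comm: "f \<oplus>\<^bsub>category_ring C\<^esub> g = g \<oplus>\<^bsub>category_ring C\<^esub> f"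
    if "f \<in> carrier (category_ring C)" "g \<in> carrier (category_ring C)" for f g
    by (rule cr_ext) (use that cl in \<open>auto simp: cr_add_app cr_app comm_monoid.m_comm[OF hom_cmon]\<close>)
  show ?thesis
  proof (rule abelian_groupI)
    fix x y z
    assume "x \<in> carrier (category_ring C)" "y \<in> carrier (category_ring C)"
      "z \<in> carrier (category_ring C)"
    then show "(x \<oplus>\<^bsub>category_ring C\<^esub> y) \<oplus>\<^bsub>category_ring C\<^esub> z =
        x \<oplus>\<^bsub>category_ring C\<^esub> (y \<oplus>\<^bsub>category_ring C\<^esub> z)"
      by (simp add: category_ring_def G.m_assoc)
  next
    fix x assume "x \<in> carrier (category_ring C)"
    then show "\<exists>y\<in>carrier (category_ring C). y \<oplus>\<^bsub>category_ring C\<^esub> x = \<zero>\<^bsub>category_ring C\<^esub>"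
      unfolding category_ring_def by (auto intro: G.l_inv_ex)
  qed (use cl comm in \<open>auto simp: category_ring_def\<close>)
qed

lemma cr_mult_closed:
  assumes f: "f \<in> carrier (category_ring C)" and g: "g \<in> carrier (category_ring C)"
  shows "f \<otimes>\<^bsub>category_ring C\<^esub> g \<in> carrier (category_ring C)"
proof -
  obtain S where S: "finite S" "S \<subseteq> Obj C"
    "\<And>X Y. \<lbrakk>X \<in> Obj C; Y \<in> Obj C; X \<notin> S \<or> Y \<notin> S\<rbrakk> \<Longrightarrow> f (X, Y) = \<one>\<^bsub>Hom C Y X\<^esub>"
    using cr_supp[OF f] by blast
  obtain T where T: "finite T" "T \<subseteq> Obj C"
    "\<And>X Y. \<lbrakk>X \<in> Obj C; Y \<in> Obj C; X \<notin> T \<or> Y \<notin> T\<rbrakk> \<Longrightarrow> g (X, Y) = \<one>\<^bsub>Hom C Y X\<^esub>"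
    using cr_supp[OF g] by blast
  show ?thesis
  proof (rule cr_memI)
    show "f \<otimes>\<^bsub>category_ring C\<^esub> g \<in> extensional (Obj C \<times> Obj C)"
      by (simp add: category_ring_def category_ring_mult_def)
    show "finite (S \<union> T)" using S T by simp
    fix X Z
    assume X: "X \<in> Obj C" and Z: "Z \<in> Obj C"
    interpret H: comm_monoid "Hom C Z X" using hom_cmon X Z by blast
    have eq: "(f \<otimes>\<^bsub>category_ring C\<^esub> g) (X, Z) =
           finprod (Hom C Z X) (\<lambda>Y. Comp C Z Y X (f (X, Y)) (g (Y, Z))) S"
      by (rule cr_mult_app) (use f g X Z S in auto)
    show "(f \<otimes>\<^bsub>category_ring C\<^esub> g) (X, Z) \<in> carrier (Hom C Z X)"
      unfolding eq
    proof (intro H.finprod_closed Pi_I)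
      fix Y assume "Y \<in> S"
      then have "Y \<in> Obj C" using S(2) by blast
      then show "Comp C Z Y X (f (X, Y)) (g (Y, Z)) \<in> carrier (Hom C Z X)"
        by (intro comp_closed cr_app f g X Z)
    qed
    assume nin: "X \<notin> S \<union> T \<or> Z \<notin> S \<union> T"
    have "Comp C Z Y X (f (X, Y)) (g (Y, Z)) = \<one>\<^bsub>Hom C Z X\<^esub>" if "Y \<in> S" for Y
    proof -
      have "Y \<in> Obj C" using that S by blast
      then have "f (X, Y) \<in> carrier (Hom C Y X)" "g (Y, Z) \<in> carrier (Hom C Z Y)"
        "f (X, Y) = \<one>\<^bsub>Hom C Y X\<^esub> \<or> g (Y, Z) = \<one>\<^bsub>Hom C Z Y\<^esub>"
        using f g X Z nin S(3) T(3) by (auto simp: cr_app)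
      then show ?thesis
        using X Z \<open>Y \<in> Obj C\<close> comp_zero_left comp_zero_right by fastforce
    qed
    then show "(f \<otimes>\<^bsub>category_ring C\<^esub> g) (X, Z) = \<one>\<^bsub>Hom C Z X\<^esub>"
      unfolding eq by (rule H.finprod_one_eqI)
  qed
qed

lemma cr_mult_assoc:
  assumes f: "f \<in> carrier (category_ring C)" and g: "g \<in> carrier (category_ring C)"
    and h: "h \<in> carrier (category_ring C)"
  shows "(f \<otimes>\<^bsub>category_ring C\<^esub> g) \<otimes>\<^bsub>category_ring C\<^esub> h =
           f \<otimes>\<^bsub>category_ring C\<^esub> (g \<otimes>\<^bsub>category_ring C\<^esub> h)"
proof (rule cr_ext)
  fix X W
  assume X: "X \<in> Obj C" and W: "W \<in> Obj C"
  obtain S where S: "finite S" "S \<subseteq> Obj C"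
    "\<And>X Y. \<lbrakk>X \<in> Obj C; Y \<in> Obj C; X \<notin> S \<or> Y \<notin> S\<rbrakk> \<Longrightarrow> f (X, Y) = \<one>\<^bsub>Hom C Y X\<^esub>"
    using cr_supp[OF f] by blast
  obtain T where T: "finite T" "T \<subseteq> Obj C"
    "\<And>X Y. \<lbrakk>X \<in> Obj C; Y \<in> Obj C; X \<notin> T \<or> Y \<notin> T\<rbrakk> \<Longrightarrow> h (X, Y) = \<one>\<^bsub>Hom C Y X\<^esub>"
    using cr_supp[OF h] by blast
  have SO: "Y \<in> Obj C" if "Y \<in> S" for Y using that S by blast
  have TO: "Y \<in> Obj C" if "Y \<in> T" for Y using that T by blast
  interpret H: comm_monoid "Hom C W X" using hom_cmon X W by blast
  note [simp] = cr_app comp_closed X W SO TO f g h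
  let ?t = "\<lambda>Y Z. Comp C W Y X (f (X, Y)) (Comp C W Z Y (g (Y, Z)) (h (Z, W)))"
  have "((f \<otimes>\<^bsub>category_ring C\<^esub> g) \<otimes>\<^bsub>category_ring C\<^esub> h) (X, W) =
      finprod (Hom C W X) (\<lambda>Z. Comp C W Z X ((f \<otimes>\<^bsub>category_ring C\<^esub> g) (X, Z)) (h (Z, W))) T"
    by (rule cr_mult_app) (use T in \<open>auto simp: cr_mult_closed\<close>)
  also have "\<dots> = finprod (Hom C W X) (\<lambda>Z. finprod (Hom C W X) (\<lambda>Y. ?t Y Z) S) T"
  proof (rule H.finprod_cong', goal_cases)
    case (3 Z)
    then have Z: "Z \<in> Obj C" by simp
    have "(f \<otimes>\<^bsub>category_ring C\<^esub> g) (X, Z) =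
        finprod (Hom C Z X) (\<lambda>Y. Comp C Z Y X (f (X, Y)) (g (Y, Z))) S"
      by (rule cr_mult_app) (use S Z in auto)
    then have "Comp C W Z X ((f \<otimes>\<^bsub>category_ring C\<^esub> g) (X, Z)) (h (Z, W)) =
        Comp C W Z X (finprod (Hom C Z X) (\<lambda>Y. Comp C Z Y X (f (X, Y)) (g (Y, Z))) S) (h (Z, W))"
      by simp
    also have "\<dots> = finprod (Hom C W X)
        (\<lambda>Y. Comp C W Z X (Comp C Z Y X (f (X, Y)) (g (Y, Z))) (h (Z, W))) S"
      by (rule hom_finprod[OF _ _ comp_hom_left]) (use Z S hom_group in auto)
    also have "\<dots> = finprod (Hom C W X) (\<lambda>Y. ?t Y Z) S"
      by (rule H.finprod_cong') (use Z in \<open>auto simp: comp_assoc\<close>)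
    finally show ?case .
  qed (auto intro!: H.finprod_closed)
  also have "\<dots> = finprod (Hom C W X) (\<lambda>Y. finprod (Hom C W X) (\<lambda>Z. ?t Y Z) T) S"
    by (rule finprod_swap) (use S T hom_group in auto)
  also have "\<dots> = finprod (Hom C W X)
      (\<lambda>Y. Comp C W Y X (f (X, Y)) ((g \<otimes>\<^bsub>category_ring C\<^esub> h) (Y, W))) S"
  proof (rule H.finprod_cong', goal_cases)
    case 2
    show ?case
      by (intro Pi_I comp_closed cr_app[OF f] cr_app[OF cr_mult_closed[OF g h]]) simp_all
  next
    case (3 Y)
    then have Y: "Y \<in> Obj C" by simp
    have "(g \<otimes>\<^bsub>category_ring C\<^esub> h) (Y, W) =
        finprod (Hom C W Y) (\<lambda>Z. Comp C W Z Y (g (Y, Z)) (h (Z, W))) T"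
      by (rule cr_mult_app) (use T Y in auto)
    moreover have "Comp C W Y X (f (X, Y))
        (finprod (Hom C W Y) (\<lambda>Z. Comp C W Z Y (g (Y, Z)) (h (Z, W))) T) =
        finprod (Hom C W X) (\<lambda>Z. ?t Y Z) T"
      by (rule hom_finprod[OF _ _ comp_hom_right]) (use Y T hom_group in auto)
    ultimately show ?case by simp
  qed simp
  also have "\<dots> = (f \<otimes>\<^bsub>category_ring C\<^esub> (g \<otimes>\<^bsub>category_ring C\<^esub> h)) (X, W)"
    by (rule cr_mult_app[symmetric]) (use S in \<open>auto simp: cr_mult_closed\<close>)
  finally show "((f \<otimes>\<^bsub>category_ring C\<^esub> g) \<otimes>\<^bsub>category_ring C\<^esub> h) (X, W) =
      (f \<otimes>\<^bsub>category_ring C\<^esub> (g \<otimes>\<^bsub>category_ring C\<^esub> h)) (X, W)" .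
qed (use assms in \<open>auto intro!: cr_mult_closed\<close>)

lemma cr_l_distr:
  assumes f: "f \<in> carrier (category_ring C)" and g: "g \<in> carrier (category_ring C)"
    and h: "h \<in> carrier (category_ring C)"
  shows "(f \<oplus>\<^bsub>category_ring C\<^esub> g) \<otimes>\<^bsub>category_ring C\<^esub> h =
           f \<otimes>\<^bsub>category_ring C\<^esub> h \<oplus>\<^bsub>category_ring C\<^esub> g \<otimes>\<^bsub>category_ring C\<^esub> h"
proof -
  interpret A: abelian_group "category_ring C" by (rule cr_abelian_group)
  show ?thesis
  proof (rule cr_ext)
    fix X W
    assume X: "X \<in> Obj C" and W: "W \<in> Obj C"
    obtain T where T: "finite T" "T \<subseteq> Obj C"
      "\<And>X Y. \<lbrakk>X \<in> Obj C; Y \<in> Obj C; X \<notin> T \<or> Y \<notin> T\<rbrakk> \<Longrightarrow> h (X, Y) = \<one>\<^bsub>Hom C Y X\<^esub>"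
      using cr_supp[OF h] by blast
    have TO: "Y \<in> Obj C" if "Y \<in> T" for Y using that T by blast
    interpret H: comm_monoid "Hom C W X" using hom_cmon X W by blast
    note [simp] = cr_app comp_closed X W TO f g h
    have eq: "(k \<otimes>\<^bsub>category_ring C\<^esub> h) (X, W) =
        finprod (Hom C W X) (\<lambda>Y. Comp C W Y X (k (X, Y)) (h (Y, W))) T"
      if "k \<in> carrier (category_ring C)" for k
      by (rule cr_mult_app) (use T that in auto)
    show "((f \<oplus>\<^bsub>category_ring C\<^esub> g) \<otimes>\<^bsub>category_ring C\<^esub> h) (X, W) =
        (f \<otimes>\<^bsub>category_ring C\<^esub> h \<oplus>\<^bsub>category_ring C\<^esub> g \<otimes>\<^bsub>category_ring C\<^esub> h) (X, W)"
    proof -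
      have "finprod (Hom C W X) (\<lambda>Y. Comp C W Y X ((f \<oplus>\<^bsub>category_ring C\<^esub> g) (X, Y)) (h (Y, W))) T =
          finprod (Hom C W X) (\<lambda>Y. Comp C W Y X (f (X, Y)) (h (Y, W)) \<otimes>\<^bsub>Hom C W X\<^esub>
            Comp C W Y X (g (X, Y)) (h (Y, W))) T"
        by (rule H.finprod_cong') (simp_all add: cr_add_app comp_add_left)
      also have "\<dots> = finprod (Hom C W X) (\<lambda>Y. Comp C W Y X (f (X, Y)) (h (Y, W))) T \<otimes>\<^bsub>Hom C W X\<^esub>
          finprod (Hom C W X) (\<lambda>Y. Comp C W Y X (g (X, Y)) (h (Y, W))) T"
        by (rule H.finprod_multf) simp_all
      finally show ?thesis
        using eq[OF A.a_closed[OF f g]] eq[OF f] eq[OF g] cr_add_app[OF X W] by metis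
    qed
  qed (use assms in \<open>auto intro!: cr_mult_closed\<close>)
qed

lemma cr_r_distr:
  assumes f: "f \<in> carrier (category_ring C)" and g: "g \<in> carrier (category_ring C)"
    and h: "h \<in> carrier (category_ring C)"
  shows "h \<otimes>\<^bsub>category_ring C\<^esub> (f \<oplus>\<^bsub>category_ring C\<^esub> g) =
           h \<otimes>\<^bsub>category_ring C\<^esub> f \<oplus>\<^bsub>category_ring C\<^esub> h \<otimes>\<^bsub>category_ring C\<^esub> g"
proof -
  interpret A: abelian_group "category_ring C" by (rule cr_abelian_group)
  show ?thesis
  proof (rule cr_ext)
    fix X W
    assume X: "X \<in> Obj C" and W: "W \<in> Obj C"
    obtain T where T: "finite T" "T \<subseteq> Obj C"
      "\<And>X Y. \<lbrakk>X \<in> Obj C; Y \<in> Obj C; X \<notin> T \<or> Y \<notin> T\<rbrakk> \<Longrightarrow> h (X, Y) = \<one>\<^bsub>Hom C Y X\<^esub>"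
      using cr_supp[OF h] by blast
    have TO: "Y \<in> Obj C" if "Y \<in> T" for Y using that T by blast
    interpret H: comm_monoid "Hom C W X" using hom_cmon X W by blast
    note [simp] = cr_app comp_closed X W TO f g h
    have eq: "(h \<otimes>\<^bsub>category_ring C\<^esub> k) (X, W) =
        finprod (Hom C W X) (\<lambda>Y. Comp C W Y X (h (X, Y)) (k (Y, W))) T"
      if "k \<in> carrier (category_ring C)" for k
      by (rule cr_mult_app) (use T that in auto)
    show "(h \<otimes>\<^bsub>category_ring C\<^esub> (f \<oplus>\<^bsub>category_ring C\<^esub> g)) (X, W) =
        (h \<otimes>\<^bsub>category_ring C\<^esub> f \<oplus>\<^bsub>category_ring C\<^esub> h \<otimes>\<^bsub>category_ring C\<^esub> g) (X, W)"
    proof -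
      have "finprod (Hom C W X) (\<lambda>Y. Comp C W Y X (h (X, Y)) ((f \<oplus>\<^bsub>category_ring C\<^esub> g) (Y, W))) T =
          finprod (Hom C W X) (\<lambda>Y. Comp C W Y X (h (X, Y)) (f (Y, W)) \<otimes>\<^bsub>Hom C W X\<^esub>
            Comp C W Y X (h (X, Y)) (g (Y, W))) T"
        by (rule H.finprod_cong') (simp_all add: cr_add_app comp_add_right)
      also have "\<dots> = finprod (Hom C W X) (\<lambda>Y. Comp C W Y X (h (X, Y)) (f (Y, W))) T \<otimes>\<^bsub>Hom C W X\<^esub>
          finprod (Hom C W X) (\<lambda>Y. Comp C W Y X (h (X, Y)) (g (Y, W))) T"
        by (rule H.finprod_multf) simp_all
      finally show ?thesis
        using eq[OF A.a_closed[OF f g]] eq[OF f] eq[OF g] cr_add_app[OF X W] by metis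
    qed
  qed (use assms in \<open>auto intro!: cr_mult_closed\<close>)
qed

lemma category_ring_is_ring: "nonunital_ring (category_ring C)"
  by (intro nonunital_ring.intro nonunital_ring_axioms.intro cr_abelian_group cr_mult_closed
      cr_mult_assoc cr_l_distr cr_r_distr)

lemma homogeneous_app:
  "\<lbrakk>X' \<in> Obj C; Y' \<in> Obj C\<rbrakk> \<Longrightarrow>
     homogeneous C X Y a (X', Y') = (if X' = X \<and> Y' = Y then a else \<one>\<^bsub>Hom C Y' X'\<^esub>)"
  by (simp add: homogeneous_def)

lemma homogeneous_carrier:
  assumes "X \<in> Obj C" "Y \<in> Obj C" "a \<in> carrier (Hom C Y X)"
  shows "homogeneous C X Y a \<in> carrier (category_ring C)"
proof (rule cr_memI[of _ "{X, Y}"])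
  show "homogeneous C X Y a \<in> extensional (Obj C \<times> Obj C)"
    by (simp add: homogeneous_def)
qed (use assms one_in in \<open>auto simp: homogeneous_app\<close>)

lemma category_ring_grade_eq:
  assumes "X \<in> Obj C" "Y \<in> Obj C"
  shows "category_ring_grade C (X, Y) = homogeneous C X Y ` carrier (Hom C Y X)"
proof (intro equalityI subsetI)
  fix f assume "f \<in> category_ring_grade C (X, Y)"
  then have f: "f \<in> carrier (category_ring C)"
    and z: "\<And>X' Y'. \<lbrakk>X' \<in> Obj C; Y' \<in> Obj C; (X', Y') \<noteq> (X, Y)\<rbrakk> \<Longrightarrow> f (X', Y') = \<one>\<^bsub>Hom C Y' X'\<^esub>"
    by (auto simp: category_ring_grade_def)
  have "f = homogeneous C X Y (f (X, Y))"
    by (rule cr_ext) (use f assms z in \<open>auto simp: homogeneous_app homogeneous_carrier cr_app\<close>)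
  then show "f \<in> homogeneous C X Y ` carrier (Hom C Y X)"
    using f assms cr_app by blast
next
  fix f assume "f \<in> homogeneous C X Y ` carrier (Hom C Y X)"
  then show "f \<in> category_ring_grade C (X, Y)"
    using assms by (auto simp: category_ring_grade_def homogeneous_carrier homogeneous_app)
qed

lemma category_ring_mult_homogeneous:
  assumes "X \<in> Obj C" "Y \<in> Obj C" "Y' \<in> Obj C" "Z \<in> Obj C"
    and a: "a \<in> carrier (Hom C Y X)" and b: "b \<in> carrier (Hom C Z Y')"
  shows "homogeneous C X Y a \<otimes>\<^bsub>category_ring C\<^esub> homogeneous C Y' Z b =
           (if Y = Y' then homogeneous C X Z (Comp C Z Y X a b) else \<zero>\<^bsub>category_ring C\<^esub>)"
proof -
  interpret A: nonunital_ring "category_ring C" by (rule category_ring_is_ring)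
  show ?thesis
  proof (rule cr_ext)
    fix V W
    assume V: "V \<in> Obj C" and W: "W \<in> Obj C"
    interpret H: comm_monoid "Hom C W V" using hom_cmon V W by blast
    have cl: "Comp C W Y V (homogeneous C X Y a (V, Y)) (homogeneous C Y' Z b (Y, W))
        \<in> carrier (Hom C W V)"
      using assms V W cr_app[OF homogeneous_carrier] by (intro comp_closed) blast+
    have "(homogeneous C X Y a \<otimes>\<^bsub>category_ring C\<^esub> homogeneous C Y' Z b) (V, W) =
        finprod (Hom C W V)
          (\<lambda>U. Comp C W U V (homogeneous C X Y a (V, U)) (homogeneous C Y' Z b (U, W))) {Y}"
      by (rule cr_mult_app) (use assms V W in \<open>auto simp: homogeneous_carrier homogeneous_app\<close>)
    also have "\<dots> = Comp C W Y V (homogeneous C X Y a (V, Y)) (homogeneous C Y' Z b (Y, W))"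
      using cl by simp
    also have "\<dots> = (if Y = Y' then homogeneous C X Z (Comp C Z Y X a b)
        else \<zero>\<^bsub>category_ring C\<^esub>) (V, W)"
      using assms V W
      by (auto simp: homogeneous_app cr_zero_app comp_zero_left comp_zero_right one_in)
    finally show "(homogeneous C X Y a \<otimes>\<^bsub>category_ring C\<^esub> homogeneous C Y' Z b) (V, W) =
        (if Y = Y' then homogeneous C X Z (Comp C Z Y X a b) else \<zero>\<^bsub>category_ring C\<^esub>) (V, W)" .
  qed (use assms in \<open>auto simp: homogeneous_carrier comp_closed intro!: cr_mult_closed\<close>)
qed

lemma cr_finsum_app:
  assumes "finite J" "x \<in> J \<rightarrow> carrier (category_ring C)" "X \<in> Obj C" "Y \<in> Obj C"
  shows "finsum (category_ring C) x J (X, Y) = finprod (Hom C Y X) (\<lambda>j. x j (X, Y)) J"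
proof -
  interpret A: abelian_group "category_ring C" by (rule cr_abelian_group)
  interpret H: comm_monoid "Hom C Y X" using hom_cmon assms by blast
  show ?thesis
    using assms(1,2)
  proof (induction J rule: finite_induct)
    case empty
    then show ?case using assms by (simp add: cr_zero_app)
  next
    case (insert j J)
    then have "x \<in> J \<rightarrow> carrier (category_ring C)" "x j \<in> carrier (category_ring C)" by auto
    with insert show ?case
      using assms(3,4)
      by (subst A.finsum_insert, simp_all, subst H.finprod_insert)
        (auto simp: cr_add_app Pi_iff cr_app)
  qed
qed

lemma cr_grade_subgroup:
  assumes "p \<in> Obj C \<times> Obj C"
  shows "additive_subgroup (category_ring_grade C p) (category_ring C)"
proof -
  interpret A: abelian_group "category_ring C" by (rule cr_abelian_group)
  obtain X Y where p: "p = (X, Y)" "X \<in> Obj C" "Y \<in> Obj C" using assms by blast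
  show ?thesis
  proof (intro additive_subgroup.intro A.add.subgroupI)
    show "category_ring_grade C p \<subseteq> carrier (category_ring C)"
      by (auto simp: category_ring_grade_def split: prod.splits)
    have "\<zero>\<^bsub>category_ring C\<^esub> \<in> category_ring_grade C p"
      by (auto simp: p category_ring_grade_def cr_zero_app)
    then show "category_ring_grade C p \<noteq> {}" by blast
    fix f assume f: "f \<in> category_ring_grade C p"
    then have fc: "f \<in> carrier (category_ring C)"
      by (auto simp: category_ring_grade_def p)
    have "(\<ominus>\<^bsub>category_ring C\<^esub> f) (X', Y') = \<one>\<^bsub>Hom C Y' X'\<^esub>"
      if "X' \<in> Obj C" "Y' \<in> Obj C" "(X', Y') \<noteq> (X, Y)" for X' Y'
    proof -
      interpret H: comm_group "Hom C Y' X'" using hom_group that by blast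
      have "(\<ominus>\<^bsub>category_ring C\<^esub> f \<oplus>\<^bsub>category_ring C\<^esub> f) (X', Y') = \<one>\<^bsub>Hom C Y' X'\<^esub>"
        using fc that by (simp add: A.l_neg cr_zero_app)
      moreover have "f (X', Y') = \<one>\<^bsub>Hom C Y' X'\<^esub>"
        using f that by (auto simp: category_ring_grade_def p)
      moreover have "(\<ominus>\<^bsub>category_ring C\<^esub> f) (X', Y') \<in> carrier (Hom C Y' X')"
        using fc that by (simp add: cr_app)
      ultimately show ?thesis using that by (simp add: cr_add_app)
    qed
    then show "\<ominus>\<^bsub>category_ring C\<^esub> f \<in> category_ring_grade C p"
      using fc by (auto simp: category_ring_grade_def p)
    fix g assume g: "g \<in> category_ring_grade C p"
    then show "f \<oplus>\<^bsub>category_ring C\<^esub> g \<in> category_ring_grade C p"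
      using f by (auto simp: category_ring_grade_def p cr_add_app one_in
          monoid.l_one[OF comm_monoid.axioms(1)[OF hom_cmon]])
  qed
qed

lemma cr_direct_sum:
  "internal_direct_sum (category_ring C) (Obj C \<times> Obj C) (category_ring_grade C)
     (carrier (category_ring C))"
  unfolding internal_direct_sum_def
proof (intro conjI ballI allI impI)
  interpret A: abelian_group "category_ring C" by (rule cr_abelian_group)
  let ?R = "category_ring C" and ?G = "category_ring_grade C" and ?O = "Obj C \<times> Obj C"
  have sub: "?G p \<subseteq> carrier ?R" for p
    by (auto simp: category_ring_grade_def split: prod.splits)
  show "additive_subgroup (?G p) ?R" if "p \<in> ?O" for p
    using that by (rule cr_grade_subgroup)
  show "carrier ?R = generate (add_monoid ?R) (\<Union>p\<in>?O. ?G p)"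
  proof
    show "generate (add_monoid ?R) (\<Union>p\<in>?O. ?G p) \<subseteq> carrier ?R"
      using A.add.generate_incl[of "\<Union>p\<in>?O. ?G p"] sub by auto
    show "carrier ?R \<subseteq> generate (add_monoid ?R) (\<Union>p\<in>?O. ?G p)"
    proof
      fix f assume f: "f \<in> carrier ?R"
      obtain S where S: "finite S" "S \<subseteq> Obj C"
        "\<And>X Y. \<lbrakk>X \<in> Obj C; Y \<in> Obj C; X \<notin> S \<or> Y \<notin> S\<rbrakk> \<Longrightarrow> f (X, Y) = \<one>\<^bsub>Hom C Y X\<^esub>"
        using cr_supp[OF f] by blast
      let ?x = "\<lambda>(X, Y). homogeneous C X Y (f (X, Y))"
      have x: "?x \<in> S \<times> S \<rightarrow> carrier ?R"
        using S f by (auto intro!: homogeneous_carrier cr_app)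
      have f_eq: "f = finsum ?R ?x (S \<times> S)"
      proof (rule cr_ext)
        fix X Y assume XY: "X \<in> Obj C" "Y \<in> Obj C"
        interpret H: comm_monoid "Hom C Y X" using hom_cmon XY by blast
        have "finsum ?R ?x (S \<times> S) (X, Y) = finprod (Hom C Y X) (\<lambda>p. ?x p (X, Y)) (S \<times> S)"
          by (rule cr_finsum_app) (use S x XY in auto)
        also have "\<dots> = finprod (Hom C Y X)
            (\<lambda>p. if (X, Y) = p then f (X, Y) else \<one>\<^bsub>Hom C Y X\<^esub>) (S \<times> S)"
        proof (rule H.finprod_cong')
          fix p assume "p \<in> S \<times> S"
          then show "?x p (X, Y) = (if (X, Y) = p then f (X, Y) else \<one>\<^bsub>Hom C Y X\<^esub>)"
            using XY by (cases p) (auto simp: homogeneous_app)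
        qed (use XY f in \<open>auto simp: cr_app one_in\<close>)
        also have "\<dots> = f (X, Y)"
        proof (cases "(X, Y) \<in> S \<times> S")
          case True
          then show ?thesis
            using S XY f H.finprod_singleton[of "(X, Y)" "S \<times> S" "\<lambda>_. f (X, Y)"]
            by (simp add: cr_app Pi_def)
        next
          case False
          then have "finprod (Hom C Y X)
              (\<lambda>p. if (X, Y) = p then f (X, Y) else \<one>\<^bsub>Hom C Y X\<^esub>) (S \<times> S) = \<one>\<^bsub>Hom C Y X\<^esub>"
            by (intro H.finprod_one_eqI) auto
          with False S(3) XY show ?thesis by auto
        qed
        finally show "f (X, Y) = finsum ?R ?x (S \<times> S) (X, Y)" by simp
      qed (use f x in \<open>auto intro!: A.finsum_closed\<close>)
      have "finsum ?R ?x J \<in> generate (add_monoid ?R) (\<Union>p\<in>?O. ?G p)"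
        if "finite J" "J \<subseteq> S \<times> S" for J
        using that
      proof (induction J rule: finite_induct)
        case empty
        then show ?case using generate.one[of "add_monoid ?R"] by simp
      next
        case (insert p J)
        obtain X Y where p: "p = (X, Y)" "X \<in> Obj C" "Y \<in> Obj C" using insert S by blast
        then have "?x p \<in> ?G p" using f by (auto simp: category_ring_grade_eq cr_app)
        then have "?x p \<in> generate (add_monoid ?R) (\<Union>p\<in>?O. ?G p)"
          using p by (intro generate.incl) blast
        moreover have "finsum ?R ?x (insert p J) = ?x p \<oplus>\<^bsub>?R\<^esub> finsum ?R ?x J"
          using insert x by (intro A.finsum_insert) (auto simp: Pi_iff)
        ultimately show ?case
          using insert generate.eng[of "?x p" "add_monoid ?R"] by simp
      qed
      from this[OF _ subset_refl] show "f \<in> generate (add_monoid ?R) (\<Union>p\<in>?O. ?G p)"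
        using S(1) by (subst f_eq) simp
    qed
  qed
  fix J x p
  assume J: "finite J \<and> J \<subseteq> ?O \<and> x \<in> (\<Pi> p\<in>J. ?G p) \<and> finsum ?R x J = \<zero>\<^bsub>?R\<^esub>" and p: "p \<in> J"
  have xc: "x \<in> J \<rightarrow> carrier ?R" using J sub by blast
  obtain X Y where XY: "p = (X, Y)" "X \<in> Obj C" "Y \<in> Obj C" using J p by blast
  interpret H: comm_monoid "Hom C Y X" using hom_cmon XY by blast
  have off: "x q (V, W) = \<one>\<^bsub>Hom C W V\<^esub>"
    if "q \<in> J" "V \<in> Obj C" "W \<in> Obj C" "q \<noteq> (V, W)" for q V W
  proof -
    have "x q \<in> ?G q" using J that by blast
    then show ?thesis using that by (auto simp: category_ring_grade_def split: prod.splits)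
  qed
  have "\<one>\<^bsub>Hom C Y X\<^esub> = finsum ?R x J (X, Y)"
    using J XY by (simp add: cr_zero_app)
  also have "\<dots> = finprod (Hom C Y X) (\<lambda>q. x q (X, Y)) J"
    by (rule cr_finsum_app) (use J xc XY in auto)
  also have "\<dots> = finprod (Hom C Y X) (\<lambda>q. if p = q then x q (X, Y) else \<one>\<^bsub>Hom C Y X\<^esub>) J"
    by (rule H.finprod_cong') (use XY off xc in \<open>auto simp: cr_app Pi_iff one_in\<close>)
  also have "\<dots> = x p (X, Y)"
    using J p xc XY by (intro H.finprod_singleton) (auto simp: cr_app Pi_iff)
  finally have 1: "x p (X, Y) = \<one>\<^bsub>Hom C Y X\<^esub>" by simp
  show "x p = \<zero>\<^bsub>?R\<^esub>"
  proof (rule cr_ext)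
    fix V W assume "V \<in> Obj C" "W \<in> Obj C"
    then show "x p (V, W) = \<zero>\<^bsub>?R\<^esub> (V, W)"
      using 1 off[OF p] XY by (cases "p = (V, W)") (auto simp: cr_zero_app)
  qed (use p xc in auto)
qed

end

lemma pair_groupoid_is_groupoid: "groupoid (pair_groupoid X)"
  by unfold_locales (auto simp: pair_groupoid_def)

theorem category_ring_graded:
  assumes "preadditive_category C"
  shows "graded_ring (pair_groupoid (Obj C)) (category_ring C) (category_ring_grade C)"
proof -
  interpret preadditive_category C by fact
  interpret R: nonunital_ring "category_ring C" by (rule category_ring_is_ring)
  show ?thesis
  proof (intro graded_ring.intro graded_ring_axioms.intro pair_groupoid_is_groupoid
      category_ring_is_ring)
    show "internal_direct_sum (category_ring C) (Garr (pair_groupoid (Obj C)))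
        (category_ring_grade C) (carrier (category_ring C))"
      using cr_direct_sum by (simp add: pair_groupoid_def)
  next
    fix g h a b
    assume *: "g \<in> Garr (pair_groupoid (Obj C))" "h \<in> Garr (pair_groupoid (Obj C))"
      "a \<in> category_ring_grade C g" "b \<in> category_ring_grade C h"
    obtain X Y where g: "g = (X, Y)" "X \<in> Obj C" "Y \<in> Obj C"
      using *(1) by (auto simp: pair_groupoid_def)
    obtain Y' Z where h: "h = (Y', Z)" "Y' \<in> Obj C" "Z \<in> Obj C"
      using *(2) by (auto simp: pair_groupoid_def)
    obtain a' where a: "a = homogeneous C X Y a'" "a' \<in> carrier (Hom C Y X)"
      using *(3) g by (auto simp: category_ring_grade_eq)
    obtain b' where b: "b = homogeneous C Y' Z b'" "b' \<in> carrier (Hom C Z Y')"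
      using *(4) h by (auto simp: category_ring_grade_eq)
    show "a \<otimes>\<^bsub>category_ring C\<^esub> b \<in> category_ring_grade C (Gmul (pair_groupoid (Obj C)) g h)"
      if "Gsrc (pair_groupoid (Obj C)) g = Gtgt (pair_groupoid (Obj C)) h"
      using that a b g h
      by (auto simp: pair_groupoid_def category_ring_mult_homogeneous category_ring_grade_eq
          comp_closed)
    show "a \<otimes>\<^bsub>category_ring C\<^esub> b = \<zero>\<^bsub>category_ring C\<^esub>"
      if "Gsrc (pair_groupoid (Obj C)) g \<noteq> Gtgt (pair_groupoid (Obj C)) h"
      using that a b g h by (auto simp: pair_groupoid_def category_ring_mult_homogeneous)
  qed
qed

end

theory Submission
  imports Defs
begin

text \<open>
  Write \<open>R\<close> for the category ring, \<open>J\<close> for its graded radical, and, for an object \<open>x\<close>, \<open>E\<close> for the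
  endomorphism ring of \<open>x\<close>, which is the corner \<open>R\<^sub>(\<^sub>x\<^sub>,\<^sub>x\<^sub>)\<close> of \<open>R\<close>. The proof compares graded right
  ideals of \<open>R\<close> with right ideals of \<open>E\<close> by means of two monotone maps: restriction
  \<open>res U = U \<inter> E\<close>, and the largest graded right ideal \<open>coind N\<close> whose restriction is \<open>N\<close>. They
  satisfy \<open>res (coind N) = N\<close> and \<open>U \<subseteq> coind (res U)\<close>. Besides what lies over \<open>N\<close> in row \<open>x\<close>, the
  ideal \<open>coind N\<close> contains all other rows of \<open>R\<close>, so \<open>coind\<close> sends maximal right ideals to
  gr-maximal ones, and a gr-maximal \<open>M\<close> either contains row \<open>x\<close> or is \<open>coind N\<close> for the maximal
  right ideal \<open>N = res M\<close>. Hence \<open>res J\<close> is the Jacobson radical of \<open>E\<close> (\<open>res_radical\<close>), and the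
  part of \<open>coind (res J)\<close> in row \<open>x\<close> lies in \<open>J\<close> (\<open>coind_jac_row\<close>).

  The quotient \<open>R/J\<close> is a sum of gr-simple right ideals iff \<open>R\<close> is the sum of \<open>J\<close> and of graded
  right ideals that are minimal over \<open>J\<close> (\<open>gr_semilocal_iff\<close>); this and its ungraded version, the
  case of a trivial grading, turn both sides of the equivalence into statements about \<open>R\<close> and \<open>E\<close>
  themselves. It presupposes that \<open>J\<close> is a two-sided ideal, which holds in any groupoid graded ring
  (\<open>gr_radical_left_ideal\<close>).

  If \<open>U\<close> is minimal over \<open>J\<close>, then \<open>res U\<close> is \<open>res J\<close> or minimal over it: a right ideal \<open>V\<close> between
  \<open>res J\<close> and \<open>res U\<close> is the restriction of \<open>U \<inter> coind V\<close>, which is \<open>J\<close> or \<open>U\<close>. Restricting a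
  decomposition of \<open>R\<close> thus gives one of \<open>E\<close> (\<open>semilocal_corner\<close>). Conversely, if \<open>V\<close> is minimal
  over the radical of \<open>E\<close>, then \<open>J + V R\<close> is minimal over \<open>J\<close> (\<open>gen_minimal_over\<close>): a graded right
  ideal \<open>W\<close> between them restricts to \<open>V\<close>, and then contains \<open>V R\<close>, or to \<open>res J\<close>, and then its row
  \<open>x\<close> lies in \<open>coind (res J)\<close>, hence in \<open>J\<close>. As the identity of \<open>x\<close> is a sum of elements
  of the radical and of such ideals \<open>V\<close>, row \<open>x\<close> of \<open>R\<close> is covered (\<open>row_semisimple\<close>). Rows of zero
  objects vanish, and \<open>R\<close> is the sum of its rows.
\<close>

no_notation Sum_Type.Plus (infixr \<open><+>\<close> 65)

section \<open>Additive subgroups\<close>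

abbreviation span :: "('a, 'b) ring_scheme \<Rightarrow> 'a set \<Rightarrow> 'a set" where
  "span R S \<equiv> generate (add_monoid R) S"

lemma (in abelian_group) add_inverse_unique:
  assumes "x \<in> carrier G" "y \<in> carrier G" "x \<oplus> y = \<zero>"
  shows "y = \<ominus> x"
  using assms by (metis minus_equality a_comm minus_minus)

lemma additive_map_zero:
  assumes "abelian_group R" "abelian_group S" and "f \<in> carrier R \<rightarrow> carrier S"
    and "\<And>x y. \<lbrakk>x \<in> carrier R; y \<in> carrier R\<rbrakk> \<Longrightarrow> f (x \<oplus>\<^bsub>R\<^esub> y) = f x \<oplus>\<^bsub>S\<^esub> f y"
  shows "f \<zero>\<^bsub>R\<^esub> = \<zero>\<^bsub>S\<^esub>"
proof -
  interpret R: abelian_group R by fact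
  interpret S: abelian_group S by fact
  have "f \<zero>\<^bsub>R\<^esub> \<oplus>\<^bsub>S\<^esub> f \<zero>\<^bsub>R\<^esub> = f \<zero>\<^bsub>R\<^esub>" using assms(4)[of "\<zero>\<^bsub>R\<^esub>" "\<zero>\<^bsub>R\<^esub>"] by simp
  moreover have "f \<zero>\<^bsub>R\<^esub> \<in> carrier S" using assms(3) by auto
  ultimately show ?thesis using S.add.l_cancel_one by blast
qed

lemma additive_map_minus:
  assumes "abelian_group R" "abelian_group S" and "f \<in> carrier R \<rightarrow> carrier S"
    and "\<And>x y. \<lbrakk>x \<in> carrier R; y \<in> carrier R\<rbrakk> \<Longrightarrow> f (x \<oplus>\<^bsub>R\<^esub> y) = f x \<oplus>\<^bsub>S\<^esub> f y"
    and "x \<in> carrier R"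
  shows "f (\<ominus>\<^bsub>R\<^esub> x) = \<ominus>\<^bsub>S\<^esub> f x"
proof -
  interpret R: abelian_group R by fact
  interpret S: abelian_group S by fact
  have "f x \<oplus>\<^bsub>S\<^esub> f (\<ominus>\<^bsub>R\<^esub> x) = f \<zero>\<^bsub>R\<^esub>"
    using assms(4)[of x "\<ominus>\<^bsub>R\<^esub> x"] assms(5) by (simp add: R.r_neg)
  then show ?thesis
    using additive_map_zero[OF assms(1-4)] assms(3,5) by (intro S.add_inverse_unique) auto
qed

lemma additive_subgroup_vimage:
  assumes "abelian_group R" "abelian_group S" and "f \<in> carrier R \<rightarrow> carrier S"
    and "\<And>x y. \<lbrakk>x \<in> carrier R; y \<in> carrier R\<rbrakk> \<Longrightarrow> f (x \<oplus>\<^bsub>R\<^esub> y) = f x \<oplus>\<^bsub>S\<^esub> f y"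
    and K: "additive_subgroup K S"
  shows "additive_subgroup {x \<in> carrier R. f x \<in> K} R"
proof -
  interpret R: abelian_group R by fact
  interpret K: additive_subgroup K S by fact
  interpret S: abelian_group S by fact
  have "\<zero>\<^bsub>R\<^esub> \<in> {x \<in> carrier R. f x \<in> K}"
    using additive_map_zero[OF assms(1-4)] K.zero_closed by simp
  then show ?thesis
    using additive_map_minus[OF assms(1-4)] assms(4) K.a_inv_closed
    by (intro additive_subgroup.intro R.add.subgroupI) auto
qed

lemma additive_subgroup_image:
  assumes "abelian_group R" "abelian_group S" and "f \<in> carrier R \<rightarrow> carrier S"
    and "\<And>x y. \<lbrakk>x \<in> carrier R; y \<in> carrier R\<rbrakk> \<Longrightarrow> f (x \<oplus>\<^bsub>R\<^esub> y) = f x \<oplus>\<^bsub>S\<^esub> f y"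
    and H: "additive_subgroup H R"
  shows "additive_subgroup (f ` H) S"
proof -
  interpret R: abelian_group R by fact
  interpret H: additive_subgroup H R by fact
  interpret S: abelian_group S by fact
  show ?thesis
  proof (intro additive_subgroup.intro S.add.subgroupI)
    show "f ` H \<subseteq> carrier S" using assms(3) H.a_subset by blast
    show "f ` H \<noteq> {}" using H.zero_closed by blast
    fix a assume "a \<in> f ` H"
    then obtain x where x: "a = f x" "x \<in> H" by blast
    then have "\<ominus>\<^bsub>S\<^esub> a = f (\<ominus>\<^bsub>R\<^esub> x)" using additive_map_minus[OF assms(1-4)] H.a_subset by auto
    then show "\<ominus>\<^bsub>S\<^esub> a \<in> f ` H" using x H.a_inv_closed by blast
    fix b assume "b \<in> f ` H"
    then obtain y where y: "b = f y" "y \<in> H" by blast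
    then have "a \<oplus>\<^bsub>S\<^esub> b = f (x \<oplus>\<^bsub>R\<^esub> y)" using x assms(4) H.a_subset by auto
    then show "a \<oplus>\<^bsub>S\<^esub> b \<in> f ` H" using x y H.a_closed by blast
  qed
qed

context abelian_group
begin

lemma span_additive_subgroup: "S \<subseteq> carrier G \<Longrightarrow> additive_subgroup (span G S) G"
  by (intro additive_subgroup.intro add.generate_is_subgroup)

lemma span_in_subgroup: "\<lbrakk>additive_subgroup H G; S \<subseteq> H\<rbrakk> \<Longrightarrow> span G S \<subseteq> H"
  by (intro add.generate_subgroup_incl additive_subgroup.a_subgroup)

text \<open>
  A tool for containments between sums of ideals: an additive map sends a span into a subgroup as
  soon as it sends the generators there.
\<close>

lemma span_map:
  assumes "abelian_group S" "f \<in> carrier G \<rightarrow> carrier S"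
    and "\<And>x y. \<lbrakk>x \<in> carrier G; y \<in> carrier G\<rbrakk> \<Longrightarrow> f (x \<oplus> y) = f x \<oplus>\<^bsub>S\<^esub> f y"
    and "additive_subgroup K S"
    and "B \<subseteq> carrier G" "\<And>b. b \<in> B \<Longrightarrow> f b \<in> K" "x \<in> span G B"
  shows "f x \<in> K"
proof -
  have "span G B \<subseteq> {x \<in> carrier G. f x \<in> K}"
    by (rule span_in_subgroup[OF additive_subgroup_vimage]) (use assms abelian_group_axioms in auto)
  then show ?thesis using assms by auto
qed

text \<open>
  When the generators already form subgroups, the negation case of an induction over the span can
  be dropped.
\<close>

lemma span_induct_plus [consumes 2, case_names zero base plus]:
  assumes "x \<in> span G (\<Union>i\<in>I. A i)" and sub: "\<And>i. i \<in> I \<Longrightarrow> additive_subgroup (A i) G"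
    and "P \<zero>" and A: "\<And>i a. \<lbrakk>i \<in> I; a \<in> A i\<rbrakk> \<Longrightarrow> P a"
    and "\<And>a b. \<lbrakk>a \<in> carrier G; b \<in> carrier G; P a; P b\<rbrakk> \<Longrightarrow> P (a \<oplus> b)"
  shows "P x"
proof -
  have Ac: "A i \<subseteq> carrier G" if "i \<in> I" for i
    using sub[OF that] additive_subgroup.a_subset by blast
  have "x \<in> carrier G \<and> P x"
    using assms(1)
  proof induction
    case (incl h)
    then show ?case using A Ac by blast
  next
    case (inv h)
    then obtain i where i: "i \<in> I" "h \<in> A i" by blast
    then have "\<ominus> h \<in> A i"
      using additive_subgroup.a_inv_closed[OF sub] by blast
    then show ?case using A Ac i by (auto simp: a_inv_def)
  qed (use assms in auto)
  then show ?thesis by simp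
qed

end

context nonunital_ring
begin

lemma mult_zero_left: "r \<in> carrier R \<Longrightarrow> \<zero> \<otimes> r = \<zero>"
  by (rule additive_map_zero[where f = "\<lambda>x. x \<otimes> r"])
    (auto simp: abelian_group_axioms m_closed l_distr)

lemma mult_zero_right: "r \<in> carrier R \<Longrightarrow> r \<otimes> \<zero> = \<zero>"
  by (rule additive_map_zero[where f = "\<lambda>x. r \<otimes> x"])
    (auto simp: abelian_group_axioms m_closed r_distr)

end

context graded_ring
begin

section \<open>Homogeneous components\<close>

lemma grade_subgroup: "\<gamma> \<in> Garr \<Gamma> \<Longrightarrow> additive_subgroup (A \<gamma>) R"
  using direct_sum by (simp add: internal_direct_sum_def)

lemma grade_carrier: "\<lbrakk>\<gamma> \<in> Garr \<Gamma>; a \<in> A \<gamma>\<rbrakk> \<Longrightarrow> a \<in> carrier R"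
  using additive_subgroup.a_subset[OF grade_subgroup] by blast

lemma grade_zero: "\<gamma> \<in> Garr \<Gamma> \<Longrightarrow> \<zero> \<in> A \<gamma>"
  using additive_subgroup.zero_closed[OF grade_subgroup] by blast

lemma grade_independent:
  "\<lbrakk>finite K; K \<subseteq> Garr \<Gamma>; x \<in> (\<Pi> \<gamma>\<in>K. A \<gamma>); finsum R x K = \<zero>; \<gamma> \<in> K\<rbrakk> \<Longrightarrow> x \<gamma> = \<zero>"
  using direct_sum by (simp add: internal_direct_sum_def)

lemma homogeneous_induct [consumes 1, case_names zero base plus]:
  assumes "r \<in> carrier R" "P \<zero>" "\<And>\<gamma> a. \<lbrakk>\<gamma> \<in> Garr \<Gamma>; a \<in> A \<gamma>\<rbrakk> \<Longrightarrow> P a"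
    and "\<And>a b. \<lbrakk>a \<in> carrier R; b \<in> carrier R; P a; P b\<rbrakk> \<Longrightarrow> P (a \<oplus> b)"
  shows "P r"
proof -
  have "r \<in> span R (\<Union>\<gamma>\<in>Garr \<Gamma>. A \<gamma>)"
    using assms(1) direct_sum by (auto simp: internal_direct_sum_def)
  then show ?thesis
    by (rule span_induct_plus) (use assms grade_subgroup in auto)
qed

text \<open>
  The function \<open>c\<close> is total and vanishes off the finite set \<open>K\<close>, so that the components of an
  element form a unique function rather than a family on an arbitrary index set.
\<close>

definition decomposes :: "'a \<Rightarrow> ('g \<Rightarrow> 'a) \<Rightarrow> bool" where
  "decomposes r c \<longleftrightarrow> (\<exists>K. finite K \<and> K \<subseteq> Garr \<Gamma> \<and> c \<in> (\<Pi> \<gamma>\<in>K. A \<gamma>) \<and>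
     (\<forall>\<gamma>. \<gamma> \<notin> K \<longrightarrow> c \<gamma> = \<zero>) \<and> r = finsum R c K)"

lemma finsum_enlarge:
  assumes "finite L" "K \<subseteq> L" "c \<in> K \<rightarrow> carrier R" "\<forall>\<gamma>. \<gamma> \<notin> K \<longrightarrow> c \<gamma> = \<zero>"
  shows "finsum R c K = finsum R c L"
  by (rule add.finprod_mono_neutral_cong_left) (use assms in auto)

lemma decomposes_common:
  assumes "decomposes r c" "decomposes s d"
  obtains K where "finite K" "K \<subseteq> Garr \<Gamma>" "c \<in> (\<Pi> \<gamma>\<in>K. A \<gamma>)" "d \<in> (\<Pi> \<gamma>\<in>K. A \<gamma>)"
    "\<And>\<gamma>. \<gamma> \<notin> K \<Longrightarrow> c \<gamma> = \<zero> \<and> d \<gamma> = \<zero>" "r = finsum R c K" "s = finsum R d K"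
proof -
  obtain K where K: "finite K" "K \<subseteq> Garr \<Gamma>" "c \<in> (\<Pi> \<gamma>\<in>K. A \<gamma>)" "\<forall>\<gamma>. \<gamma> \<notin> K \<longrightarrow> c \<gamma> = \<zero>"
    "r = finsum R c K"
    using assms(1) unfolding decomposes_def by blast
  obtain L where L: "finite L" "L \<subseteq> Garr \<Gamma>" "d \<in> (\<Pi> \<gamma>\<in>L. A \<gamma>)" "\<forall>\<gamma>. \<gamma> \<notin> L \<longrightarrow> d \<gamma> = \<zero>"
    "s = finsum R d L"
    using assms(2) unfolding decomposes_def by blast
  have "c \<in> K \<rightarrow> carrier R" "d \<in> L \<rightarrow> carrier R" using K L grade_carrier by blast+
  then have "r = finsum R c (K \<union> L)" "s = finsum R d (K \<union> L)"
    using finsum_enlarge[of "K \<union> L" K c] finsum_enlarge[of "K \<union> L" L d] K L by auto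
  moreover have "c \<in> (\<Pi> \<gamma>\<in>K \<union> L. A \<gamma>)" "d \<in> (\<Pi> \<gamma>\<in>K \<union> L. A \<gamma>)"
    using K L grade_zero by (fastforce simp: Pi_iff)+
  ultimately show thesis using K L by (intro that[of "K \<union> L"]) auto
qed

lemma decomposes_add:
  assumes "decomposes r c" "decomposes s d"
  shows "decomposes (r \<oplus> s) (\<lambda>\<gamma>. c \<gamma> \<oplus> d \<gamma>)"
proof -
  obtain K where K: "finite K" "K \<subseteq> Garr \<Gamma>" "c \<in> (\<Pi> \<gamma>\<in>K. A \<gamma>)" "d \<in> (\<Pi> \<gamma>\<in>K. A \<gamma>)"
    "\<And>\<gamma>. \<gamma> \<notin> K \<Longrightarrow> c \<gamma> = \<zero> \<and> d \<gamma> = \<zero>" "r = finsum R c K" "s = finsum R d K"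
    by (rule decomposes_common[OF assms]) blast
  have "r \<oplus> s = finsum R (\<lambda>\<gamma>. c \<gamma> \<oplus> d \<gamma>) K"
    using K grade_carrier by (subst finsum_addf) (auto simp: Pi_iff subset_iff)
  moreover have "(\<lambda>\<gamma>. c \<gamma> \<oplus> d \<gamma>) \<in> (\<Pi> \<gamma>\<in>K. A \<gamma>)"
    using K additive_subgroup.a_closed[OF grade_subgroup] by (auto simp: Pi_iff subset_iff)
  ultimately show ?thesis unfolding decomposes_def using K by (intro exI[of _ K]) auto
qed

lemma decomposes_homogeneous:
  assumes "\<gamma> \<in> Garr \<Gamma>" "a \<in> A \<gamma>"
  shows "decomposes a (\<lambda>\<delta>. if \<delta> = \<gamma> then a else \<zero>)"
  unfolding decomposes_def using assms grade_carrier[OF assms] by (intro exI[of _ "{\<gamma>}"]) auto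

lemma decomposes_zero: "decomposes \<zero> (\<lambda>\<delta>. \<zero>)"
  unfolding decomposes_def by (intro exI[of _ "{}"]) auto

lemma decomposition_exists:
  assumes "r \<in> carrier R"
  shows "\<exists>c. decomposes r c"
  using assms
proof (induction r rule: homogeneous_induct)
  case zero then show ?case using decomposes_zero by blast
next
  case (base \<gamma> a) then show ?case using decomposes_homogeneous by blast
next
  case (plus a b) then show ?case using decomposes_add by blast
qed

lemma decomposition_unique:
  assumes "decomposes r c" "decomposes r d"
  shows "c = d"
proof
  fix \<gamma>
  obtain K where K: "finite K" "K \<subseteq> Garr \<Gamma>" "c \<in> (\<Pi> \<gamma>\<in>K. A \<gamma>)" "d \<in> (\<Pi> \<gamma>\<in>K. A \<gamma>)"
    "\<And>\<gamma>. \<gamma> \<notin> K \<Longrightarrow> c \<gamma> = \<zero> \<and> d \<gamma> = \<zero>" and r: "r = finsum R c K" "r = finsum R d K"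
    using decomposes_common[OF assms] by blast
  have cd: "c \<in> K \<rightarrow> carrier R" "d \<in> K \<rightarrow> carrier R" using K grade_carrier by blast+
  show "c \<gamma> = d \<gamma>"
  proof (cases "\<gamma> \<in> K")
    case True
    have m: "(\<lambda>\<delta>. \<ominus> d \<delta>) \<in> K \<rightarrow> carrier R" using cd by auto
    have "finsum R (\<lambda>\<delta>. \<ominus> d \<delta>) K \<oplus> finsum R d K = finsum R (\<lambda>\<delta>. \<zero>) K"
    proof -
      have "finsum R (\<lambda>\<delta>. \<ominus> d \<delta> \<oplus> d \<delta>) K = finsum R (\<lambda>\<delta>. \<zero>) K"
        using cd by (intro finsum_cong') (auto simp: l_neg Pi_iff)
      then show ?thesis using cd m by (simp add: finsum_addf)
    qed
    then have "finsum R c K \<oplus> finsum R (\<lambda>\<delta>. \<ominus> d \<delta>) K = \<zero>"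
      using r cd m by (simp add: a_comm)
    then have "finsum R (\<lambda>\<delta>. c \<delta> \<oplus> \<ominus> d \<delta>) K = \<zero>"
      using cd m by (subst finsum_addf) auto
    moreover have "(\<lambda>\<delta>. c \<delta> \<oplus> \<ominus> d \<delta>) \<in> (\<Pi> \<gamma>\<in>K. A \<gamma>)"
    proof
      fix \<delta> assume "\<delta> \<in> K"
      then have s: "additive_subgroup (A \<delta>) R" "c \<delta> \<in> A \<delta>" "d \<delta> \<in> A \<delta>"
        using K grade_subgroup by auto
      then show "c \<delta> \<oplus> \<ominus> d \<delta> \<in> A \<delta>"
        by (simp add: additive_subgroup.a_closed additive_subgroup.a_inv_closed)
    qed
    ultimately have "c \<gamma> \<oplus> \<ominus> d \<gamma> = \<zero>"
      using grade_independent[OF K(1,2)] True by blast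
    then show ?thesis using cd True by (metis PiE minus_equality minus_minus a_inv_closed)
  qed (use K in auto)
qed

definition hcomp :: "'g \<Rightarrow> 'a \<Rightarrow> 'a" where
  "hcomp \<gamma> r = (THE c. decomposes r c) \<gamma>"

lemma hcomp_eqI: "decomposes r c \<Longrightarrow> hcomp \<gamma> r = c \<gamma>"
  unfolding hcomp_def by (metis the_equality decomposition_unique)

lemma hcomp_decomposes: "r \<in> carrier R \<Longrightarrow> decomposes r (\<lambda>\<gamma>. hcomp \<gamma> r)"
  using decomposition_exists hcomp_eqI by (metis ext)

lemma hcomp_in: "\<lbrakk>r \<in> carrier R; \<gamma> \<in> Garr \<Gamma>\<rbrakk> \<Longrightarrow> hcomp \<gamma> r \<in> A \<gamma>"
  using hcomp_decomposes[of r] grade_zero unfolding decomposes_def Pi_def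
  by (metis (mono_tags, lifting) mem_Collect_eq)

lemma hcomp_carrier: "\<lbrakk>r \<in> carrier R; \<gamma> \<in> Garr \<Gamma>\<rbrakk> \<Longrightarrow> hcomp \<gamma> r \<in> carrier R"
  using hcomp_in grade_carrier by blast

lemma hcomp_add:
  "\<lbrakk>r \<in> carrier R; s \<in> carrier R\<rbrakk> \<Longrightarrow> hcomp \<gamma> (r \<oplus> s) = hcomp \<gamma> r \<oplus> hcomp \<gamma> s"
  using hcomp_eqI[OF decomposes_add[OF hcomp_decomposes hcomp_decomposes]] by blast

lemma hcomp_homogeneous:
  "\<lbrakk>\<gamma> \<in> Garr \<Gamma>; a \<in> A \<gamma>\<rbrakk> \<Longrightarrow> hcomp \<delta> a = (if \<delta> = \<gamma> then a else \<zero>)"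
  using hcomp_eqI[OF decomposes_homogeneous] by blast

lemma hcomp_zero: "hcomp \<gamma> \<zero> = \<zero>"
  using hcomp_eqI[OF decomposes_zero] by blast

lemma hcomp_finsum:
  assumes "finite K" "K \<subseteq> Garr \<Gamma>" "x \<in> (\<Pi> \<delta>\<in>K. A \<delta>)" "\<gamma> \<in> K"
  shows "hcomp \<gamma> (finsum R x K) = x \<gamma>"
proof -
  have "x \<in> K \<rightarrow> carrier R" using assms grade_carrier by blast
  then have "finsum R x K = finsum R (\<lambda>\<delta>. if \<delta> \<in> K then x \<delta> else \<zero>) K"
    by (intro finsum_cong') auto
  then have "decomposes (finsum R x K) (\<lambda>\<delta>. if \<delta> \<in> K then x \<delta> else \<zero>)"
    unfolding decomposes_def using assms by (intro exI[of _ K]) auto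
  then show ?thesis using hcomp_eqI assms(4) by simp
qed

lemma hcomp_recombine:
  assumes "additive_subgroup H R" "r \<in> carrier R" "\<And>\<gamma>. \<gamma> \<in> Garr \<Gamma> \<Longrightarrow> hcomp \<gamma> r \<in> H"
  shows "r \<in> H"
proof -
  obtain K where K: "finite K" "K \<subseteq> Garr \<Gamma>" "r = finsum R (\<lambda>\<gamma>. hcomp \<gamma> r) K"
    using hcomp_decomposes[OF assms(2)] unfolding decomposes_def by blast
  have "finsum R (\<lambda>\<gamma>. hcomp \<gamma> r) K \<in> H"
    using K(1,2)
  proof (induction K rule: finite_induct)
    case empty then show ?case using additive_subgroup.zero_closed[OF assms(1)] by simp
  next
    case (insert \<gamma> K)
    then have "finsum R (\<lambda>\<gamma>. hcomp \<gamma> r) (insert \<gamma> K) = hcomp \<gamma> r \<oplus> finsum R (\<lambda>\<gamma>. hcomp \<gamma> r) K"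
      using hcomp_carrier[OF assms(2)] by (intro finsum_insert) auto
    then show ?case using insert assms(3) additive_subgroup.a_closed[OF assms(1)] by simp
  qed
  then show ?thesis using K(3) by simp
qed

lemma right_ideal_subgroup: "right_ideal R U \<Longrightarrow> additive_subgroup U R"
  by (simp add: right_ideal_def)

text \<open>
  Inside a graded ring the directness of the sum is inherited, so gradedness of a right ideal is
  only closure under taking components.
\<close>

lemma graded_right_ideal_iff:
  "graded_right_ideal \<Gamma> R A U \<longleftrightarrow>
     right_ideal R U \<and> (\<forall>u\<in>U. \<forall>\<gamma>\<in>Garr \<Gamma>. hcomp \<gamma> u \<in> U)"
proof (intro iffI conjI ballI)
  assume U: "graded_right_ideal \<Gamma> R A U"
  then show r: "right_ideal R U" by (simp add: graded_right_ideal_def)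
  fix u \<gamma> assume u: "u \<in> U" and \<gamma>: "\<gamma> \<in> Garr \<Gamma>"
  have Us: "additive_subgroup U R" using r right_ideal_subgroup by blast
  show "hcomp \<gamma> u \<in> U"
  proof (rule span_map[of R "hcomp \<gamma>"])
    show "u \<in> span R (\<Union>\<delta>\<in>Garr \<Gamma>. U \<inter> A \<delta>)"
      using U u by (auto simp: graded_right_ideal_def internal_direct_sum_def)
    show "(\<Union>\<delta>\<in>Garr \<Gamma>. U \<inter> A \<delta>) \<subseteq> carrier R" using grade_carrier by blast
  next
    fix b assume "b \<in> (\<Union>\<delta>\<in>Garr \<Gamma>. U \<inter> A \<delta>)"
    then show "hcomp \<gamma> b \<in> U"
      using hcomp_homogeneous additive_subgroup.zero_closed[OF Us] by auto
  qed (use Us abelian_group_axioms hcomp_add hcomp_carrier \<gamma> in auto)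
next
  assume U: "right_ideal R U \<and> (\<forall>u\<in>U. \<forall>\<gamma>\<in>Garr \<Gamma>. hcomp \<gamma> u \<in> U)"
  then have Us: "additive_subgroup U R" using right_ideal_subgroup by blast
  note Uc = additive_subgroup.a_subset[OF Us]
  have "additive_subgroup (U \<inter> A \<gamma>) R" if "\<gamma> \<in> Garr \<Gamma>" for \<gamma>
    using Us grade_subgroup[OF that] add.subgroups_Inter_pair
    by (simp add: additive_subgroup_def)
  moreover have "U = span R (\<Union>\<gamma>\<in>Garr \<Gamma>. U \<inter> A \<gamma>)" (is "U = ?S")
  proof
    show "?S \<subseteq> U" by (rule span_in_subgroup[OF Us]) auto
    show "U \<subseteq> ?S"
    proof
      fix u assume u: "u \<in> U"
      show "u \<in> ?S"
      proof (rule hcomp_recombine)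
        show "additive_subgroup ?S R" using Uc by (intro span_additive_subgroup) blast
        fix \<gamma> assume "\<gamma> \<in> Garr \<Gamma>"
        then show "hcomp \<gamma> u \<in> ?S" using u U Uc hcomp_in by (intro generate.incl) blast
      qed (use u Uc in auto)
    qed
  qed
  ultimately show "graded_right_ideal \<Gamma> R A U"
    using U grade_independent unfolding graded_right_ideal_def internal_direct_sum_def
    by (auto simp: Pi_iff)
qed

section \<open>Graded right ideals\<close>

abbreviation gri :: "'a set \<Rightarrow> bool" where
  "gri \<equiv> graded_right_ideal \<Gamma> R A"

lemma griI:
  assumes "additive_subgroup U R" "\<And>u r. \<lbrakk>u \<in> U; r \<in> carrier R\<rbrakk> \<Longrightarrow> u \<otimes> r \<in> U"
    and "\<And>u \<gamma>. \<lbrakk>u \<in> U; \<gamma> \<in> Garr \<Gamma>\<rbrakk> \<Longrightarrow> hcomp \<gamma> u \<in> U"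
  shows "gri U"
  using assms by (auto simp: graded_right_ideal_iff right_ideal_def)

lemma gri_subgroup: "gri U \<Longrightarrow> additive_subgroup U R"
  by (simp add: graded_right_ideal_iff right_ideal_def)

lemma gri_subset: "gri U \<Longrightarrow> U \<subseteq> carrier R"
  by (rule additive_subgroup.a_subset[OF gri_subgroup])

lemma gri_mult: "\<lbrakk>gri U; u \<in> U; r \<in> carrier R\<rbrakk> \<Longrightarrow> u \<otimes> r \<in> U"
  by (simp add: graded_right_ideal_iff right_ideal_def)

lemma gri_hcomp: "\<lbrakk>gri U; u \<in> U; \<gamma> \<in> Garr \<Gamma>\<rbrakk> \<Longrightarrow> hcomp \<gamma> u \<in> U"
  by (simp add: graded_right_ideal_iff)

lemma gri_zero: "gri U \<Longrightarrow> \<zero> \<in> U"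
  by (rule additive_subgroup.zero_closed[OF gri_subgroup])

lemma gri_add: "\<lbrakk>gri U; u \<in> U; v \<in> U\<rbrakk> \<Longrightarrow> u \<oplus> v \<in> U"
  by (rule additive_subgroup.a_closed[OF gri_subgroup])

lemma gri_homogeneousI:
  assumes "gri U" "r \<in> carrier R" "\<And>\<gamma>. \<gamma> \<in> Garr \<Gamma> \<Longrightarrow> hcomp \<gamma> r \<in> U"
  shows "r \<in> U"
  by (rule hcomp_recombine[OF gri_subgroup]) (use assms in auto)

lemma gri_span:
  assumes S: "S \<subseteq> carrier R" and "\<And>s r. \<lbrakk>s \<in> S; r \<in> carrier R\<rbrakk> \<Longrightarrow> s \<otimes> r \<in> span R S"
    and "\<And>s \<gamma>. \<lbrakk>s \<in> S; \<gamma> \<in> Garr \<Gamma>\<rbrakk> \<Longrightarrow> hcomp \<gamma> s \<in> span R S"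
  shows "gri (span R S)"
proof (rule griI)
  show sub: "additive_subgroup (span R S) R" using S by (rule span_additive_subgroup)
  fix u assume u: "u \<in> span R S"
  show "u \<otimes> r \<in> span R S" if r: "r \<in> carrier R" for r
    by (rule span_map[of R "\<lambda>x. x \<otimes> r" _ S])
      (use u r assms sub abelian_group_axioms m_closed l_distr in auto)
  show "hcomp \<gamma> u \<in> span R S" if \<gamma>: "\<gamma> \<in> Garr \<Gamma>" for \<gamma>
    by (rule span_map[of R "hcomp \<gamma>" _ S])
      (use u \<gamma> assms sub abelian_group_axioms hcomp_carrier hcomp_add in auto)
qed

lemma gri_Inter:
  assumes "\<And>M. M \<in> \<M> \<Longrightarrow> gri M"
  shows "gri (carrier R \<inter> \<Inter>\<M>)"
proof (rule griI)
  note sub = gri_subgroup[OF assms]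
  show "additive_subgroup (carrier R \<inter> \<Inter>\<M>) R"
  proof (intro additive_subgroup.intro add.subgroupI)
    show "carrier R \<inter> \<Inter>\<M> \<noteq> {}" using assms gri_zero by blast
    show "\<ominus> a \<in> carrier R \<inter> \<Inter>\<M>" if "a \<in> carrier R \<inter> \<Inter>\<M>" for a
      using that additive_subgroup.a_inv_closed[OF sub] by blast
    show "a \<oplus> b \<in> carrier R \<inter> \<Inter>\<M>" if "a \<in> carrier R \<inter> \<Inter>\<M>" "b \<in> carrier R \<inter> \<Inter>\<M>" for a b
      using that gri_add[OF assms] by blast
  qed blast
  fix u assume u: "u \<in> carrier R \<inter> \<Inter>\<M>"
  show "u \<otimes> r \<in> carrier R \<inter> \<Inter>\<M>" if "r \<in> carrier R" for r
    using u that gri_mult[OF assms] m_closed by blast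
  show "hcomp \<gamma> u \<in> carrier R \<inter> \<Inter>\<M>" if "\<gamma> \<in> Garr \<Gamma>" for \<gamma>
    using u that gri_hcomp[OF assms] hcomp_carrier by blast
qed

lemma gri_Int: "gri (U \<inter> V)" if "gri U" "gri V"
proof -
  have "U \<inter> V = carrier R \<inter> \<Inter>{U, V}" using gri_subset[OF that(1)] by blast
  then show ?thesis using gri_Inter[of "{U, V}"] that by auto
qed

lemma gri_set_add:
  assumes "gri U" "gri V"
  shows "gri (U <+> V)"
proof (rule griI)
  show "additive_subgroup (U <+> V) R"
    using assms gri_subgroup by (intro add_additive_subgroups)
  fix w assume "w \<in> U <+> V"
  then obtain u v where w: "w = u \<oplus> v" "u \<in> U" "v \<in> V" by (auto simp: set_add_def')
  then have c: "u \<in> carrier R" "v \<in> carrier R" using assms gri_subset by blast+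
  have sum: "a \<oplus> b \<in> U <+> V" if "a \<in> U" "b \<in> V" for a b using that by (auto simp: set_add_def')
  show "w \<otimes> r \<in> U <+> V" if "r \<in> carrier R" for r
    unfolding w(1) l_distr[OF c that] using that w assms gri_mult by (intro sum) auto
  show "hcomp \<gamma> w \<in> U <+> V" if "\<gamma> \<in> Garr \<Gamma>" for \<gamma>
    unfolding w(1) hcomp_add[OF c] using that w assms gri_hcomp by (intro sum) auto
qed

section \<open>The graded radical is a two-sided ideal\<close>

text \<open>
  Cancellation is where invertibility of the degrees enters: left multiplication by a homogeneous
  element annihilates components or moves them to distinct degrees, so it cannot merge any two.
\<close>

lemma left_cancel:
  assumes "g \<in> Garr \<Gamma>" "\<gamma> \<in> Garr \<Gamma>" "\<delta> \<in> Garr \<Gamma>" "Gsrc \<Gamma> g = Gtgt \<Gamma> \<gamma>" "Gsrc \<Gamma> g = Gtgt \<Gamma> \<delta>"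
    and "Gmul \<Gamma> g \<gamma> = Gmul \<Gamma> g \<delta>"
  shows "\<gamma> = \<delta>"
proof -
  obtain h where h: "h \<in> Garr \<Gamma>" "Gsrc \<Gamma> h = Gtgt \<Gamma> g" "Gmul \<Gamma> h g = Gid \<Gamma> (Gsrc \<Gamma> g)"
    using inverse[OF assms(1)] by blast
  have "Gmul \<Gamma> h (Gmul \<Gamma> g \<epsilon>) = \<epsilon>" if "\<epsilon> \<in> Garr \<Gamma>" "Gsrc \<Gamma> g = Gtgt \<Gamma> \<epsilon>" for \<epsilon>
    using h that assms(1) mul_assoc[of h g \<epsilon>] id_left[of \<epsilon>] by simp
  then show ?thesis using assms by metis
qed

lemma hcomp_mult_left:
  assumes g: "g \<in> Garr \<Gamma>" "h \<in> A g" and \<gamma>: "\<gamma> \<in> Garr \<Gamma>" "Gsrc \<Gamma> g = Gtgt \<Gamma> \<gamma>"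
    and r: "r \<in> carrier R"
  shows "hcomp (Gmul \<Gamma> g \<gamma>) (h \<otimes> r) = h \<otimes> hcomp \<gamma> r"
proof -
  have h: "h \<in> carrier R" using g grade_carrier by blast
  from r show ?thesis
  proof (induction r rule: homogeneous_induct)
    case zero then show ?case using h by (simp add: mult_zero_right hcomp_zero)
  next
    case (base \<delta> a)
    show ?case
    proof (cases "Gsrc \<Gamma> g = Gtgt \<Gamma> \<delta>")
      case True
      then have "h \<otimes> a \<in> A (Gmul \<Gamma> g \<delta>)" "Gmul \<Gamma> g \<delta> \<in> Garr \<Gamma>"
        using grade_mult mul_closed g base by auto
      moreover have "Gmul \<Gamma> g \<gamma> = Gmul \<Gamma> g \<delta> \<longleftrightarrow> \<gamma> = \<delta>"
        using left_cancel[OF g(1) \<gamma>(1) base(1) \<gamma>(2) True] by blast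
      ultimately show ?thesis using base h by (simp add: hcomp_homogeneous mult_zero_right)
    next
      case False
      then have "\<gamma> \<noteq> \<delta>" "h \<otimes> a = \<zero>" using \<gamma> grade_mult_zero g base by auto
      then show ?thesis using base h by (simp add: hcomp_homogeneous mult_zero_right hcomp_zero)
    qed
  next
    case (plus a b)
    then show ?case using h \<gamma> by (simp add: r_distr hcomp_add m_closed hcomp_carrier)
  qed
qed

lemma homogeneous_left_mult_hcomp:
  assumes g: "g \<in> Garr \<Gamma>" "h \<in> A g" and "\<gamma> \<in> Garr \<Gamma>" "r \<in> carrier R"
    and "gri M" "h \<otimes> r \<in> M"
  shows "h \<otimes> hcomp \<gamma> r \<in> M"
proof (cases "Gsrc \<Gamma> g = Gtgt \<Gamma> \<gamma>")
  case True
  then show ?thesis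
    using hcomp_mult_left[OF g assms(3) True assms(4)] gri_hcomp[OF assms(5,6)] mul_closed g assms(3)
    by metis
next
  case False
  then have "h \<otimes> hcomp \<gamma> r = \<zero>" using grade_mult_zero g hcomp_in assms by blast
  then show ?thesis using gri_zero assms by simp
qed

lemma gri_left_vimage:
  assumes g: "g \<in> Garr \<Gamma>" "h \<in> A g" and M: "gri M"
  shows "gri {r \<in> carrier R. h \<otimes> r \<in> M}"
proof (rule griI)
  have h: "h \<in> carrier R" using g grade_carrier by blast
  show "additive_subgroup {r \<in> carrier R. h \<otimes> r \<in> M} R"
    by (rule additive_subgroup_vimage)
      (use abelian_group_axioms h m_closed r_distr gri_subgroup M in auto)
  fix u r assume "u \<in> {r \<in> carrier R. h \<otimes> r \<in> M}" "r \<in> carrier R"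
  then show "u \<otimes> r \<in> {r \<in> carrier R. h \<otimes> r \<in> M}"
    using h M gri_mult by (auto simp: m_closed m_assoc[symmetric])
qed (use homogeneous_left_mult_hcomp[OF g] M hcomp_carrier in auto)

text \<open>
  The degree \<open>\<gamma>\<close> is \<open>g\<inverse> \<delta>\<close> if this product is defined; otherwise no multiple of \<open>h\<close> has a
  component of degree \<open>\<delta>\<close>.
\<close>

lemma hcomp_left_image:
  assumes g: "g \<in> Garr \<Gamma>" "h \<in> A g" and \<delta>: "\<delta> \<in> Garr \<Gamma>" and "t \<in> carrier R"
  shows "hcomp \<delta> (h \<otimes> t) = \<zero> \<or> (\<exists>\<gamma>\<in>Garr \<Gamma>. hcomp \<delta> (h \<otimes> t) = h \<otimes> hcomp \<gamma> t)"
proof (cases "Gtgt \<Gamma> \<delta> = Gtgt \<Gamma> g")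
  case True
  obtain k where k: "k \<in> Garr \<Gamma>" "Gsrc \<Gamma> k = Gtgt \<Gamma> g" "Gtgt \<Gamma> k = Gsrc \<Gamma> g"
    "Gmul \<Gamma> g k = Gid \<Gamma> (Gtgt \<Gamma> g)"
    using inverse[OF g(1)] by blast
  let ?\<gamma> = "Gmul \<Gamma> k \<delta>"
  have \<gamma>: "?\<gamma> \<in> Garr \<Gamma>" "Gsrc \<Gamma> g = Gtgt \<Gamma> ?\<gamma>"
    using k \<delta> True mul_closed mul_tgt by auto
  have "Gmul \<Gamma> g ?\<gamma> = \<delta>"
    using k \<delta> True g mul_assoc[of g k \<delta>] id_left[of \<delta>] by simp
  then show ?thesis using hcomp_mult_left[OF g \<gamma> assms(4)] \<gamma> by metis
next
  case False
  have h: "h \<in> carrier R" using g grade_carrier by blast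
  from assms(4) have "hcomp \<delta> (h \<otimes> t) = \<zero>"
  proof (induction t rule: homogeneous_induct)
    case (base \<epsilon> a)
    show ?case
    proof (cases "Gsrc \<Gamma> g = Gtgt \<Gamma> \<epsilon>")
      case True
      then have "h \<otimes> a \<in> A (Gmul \<Gamma> g \<epsilon>)" "Gmul \<Gamma> g \<epsilon> \<in> Garr \<Gamma>" "Gmul \<Gamma> g \<epsilon> \<noteq> \<delta>"
        using grade_mult mul_closed mul_tgt g base \<open>Gtgt \<Gamma> \<delta> \<noteq> Gtgt \<Gamma> g\<close> by auto
      then show ?thesis by (auto simp: hcomp_homogeneous)
    qed (use grade_mult_zero g base hcomp_zero in auto)
  qed (use h in \<open>auto simp: r_distr hcomp_add m_closed mult_zero_right hcomp_zero\<close>)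
  then show ?thesis by blast
qed

lemma gri_left_image:
  assumes g: "g \<in> Garr \<Gamma>" "h \<in> A g" and T: "gri T"
  shows "gri ((\<lambda>t. h \<otimes> t) ` T)"
proof (rule griI)
  have h: "h \<in> carrier R" using g grade_carrier by blast
  note Tc = gri_subset[OF T]
  show "additive_subgroup ((\<lambda>t. h \<otimes> t) ` T) R"
    by (rule additive_subgroup_image)
      (use abelian_group_axioms h m_closed r_distr gri_subgroup T in auto)
  fix u assume "u \<in> (\<lambda>t. h \<otimes> t) ` T"
  then obtain t where t: "u = h \<otimes> t" "t \<in> T" "t \<in> carrier R" using Tc by blast
  show "u \<otimes> r \<in> (\<lambda>t. h \<otimes> t) ` T" if "r \<in> carrier R" for r
    using t that h gri_mult[OF T] by (simp add: m_assoc)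
  show "hcomp \<gamma> u \<in> (\<lambda>t. h \<otimes> t) ` T" if "\<gamma> \<in> Garr \<Gamma>" for \<gamma>
    using hcomp_left_image[OF g that t(3)] t gri_hcomp[OF T] gri_zero[OF T] mult_zero_right[OF h]
    by (metis imageI)
qed

text \<open>
  Left multiplication by \<open>h\<close> is a homomorphism of right modules, and the inverse image of a maximal
  submodule under a homomorphism is everything or again maximal. Indeed, if \<open>T\<close> properly contains
  the inverse image \<open>N\<close> of \<open>M\<close>, then \<open>M + h T\<close> properly contains \<open>M\<close>, so it is all of \<open>R\<close>; every
  \<open>k\<close> then satisfies \<open>h k = m + h t\<close>, and \<open>k - t \<in> N \<subseteq> T\<close> gives \<open>k \<in> T\<close>.
\<close>

lemma gr_maximal_left_vimage:
  assumes g: "g \<in> Garr \<Gamma>" "h \<in> A g" and M: "gr_maximal \<Gamma> R A M"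
    and proper: "{r \<in> carrier R. h \<otimes> r \<in> M} \<noteq> carrier R"
  shows "gr_maximal \<Gamma> R A {r \<in> carrier R. h \<otimes> r \<in> M}" (is "gr_maximal \<Gamma> R A ?N")
  unfolding gr_maximal_def
proof (intro conjI allI impI proper)
  have Mg: "gri M" using M by (simp add: gr_maximal_def)
  have h: "h \<in> carrier R" using g grade_carrier by blast
  show "gri ?N" by (rule gri_left_vimage[OF g Mg])
  fix T assume T: "gri T \<and> ?N \<subseteq> T \<and> T \<noteq> carrier R"
  then have Tg: "gri T" by blast
  note Tc = gri_subset[OF Tg]
  let ?S = "M <+> ((\<lambda>t. h \<otimes> t) ` T)"
  show "T = ?N"
  proof (rule ccontr)
    assume "T \<noteq> ?N"
    then obtain t where t: "t \<in> T" "h \<otimes> t \<notin> M" using T Tc by blast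
    have S: "gri ?S" using Mg gri_left_image[OF g Tg] by (rule gri_set_add)
    have "m \<in> ?S" if "m \<in> M" for m
    proof -
      have "m = m \<oplus> h \<otimes> \<zero>" using that gri_subset[OF Mg] h by (auto simp: mult_zero_right)
      then show ?thesis using that gri_zero[OF Tg] unfolding set_add_def' by blast
    qed
    moreover have "h \<otimes> t \<in> ?S"
    proof -
      have "h \<otimes> t = \<zero> \<oplus> h \<otimes> t" using t Tc h m_closed by auto
      then show ?thesis using t gri_zero[OF Mg] unfolding set_add_def' by blast
    qed
    ultimately have all: "?S = carrier R" using M S t(2) unfolding gr_maximal_def by blast
    have "k \<in> T" if k: "k \<in> carrier R" for k
    proof -
      have "h \<otimes> k \<in> ?S" using all h k m_closed by simp
      then obtain m s where ms: "h \<otimes> k = m \<oplus> h \<otimes> s" "m \<in> M" "s \<in> T"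
        unfolding set_add_def' by blast
      have s: "s \<in> carrier R" and m: "m \<in> carrier R" using ms Tc gri_subset[OF Mg] by auto
      have "h \<otimes> (k \<ominus> s) = m"
      proof -
        have "h \<otimes> (k \<ominus> s) \<oplus> h \<otimes> s = h \<otimes> (k \<ominus> s \<oplus> s)"
          using h k s by (intro r_distr[symmetric]) auto
        also have "k \<ominus> s \<oplus> s = k" using k s by (simp add: a_minus_def a_assoc l_neg)
        finally show ?thesis
          using ms(1) m s h k by (simp add: m_closed)
      qed
      then have "k \<ominus> s \<in> T" using T ms(2) k s by auto
      then have "k \<ominus> s \<oplus> s \<in> T" using ms(3) gri_add[OF Tg] by blast
      then show ?thesis using k s by (simp add: a_minus_def a_assoc l_neg)
    qed
    then show False using T Tc by blast
  qed
qed

lemma gr_radical_gri: "gri (gr_radical \<Gamma> R A)"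
  unfolding gr_radical_def by (rule gri_Inter) (simp add: gr_maximal_def)

text \<open>
  By additivity \<open>h\<close> may be taken homogeneous. The inverse image under \<open>h\<close> of each gr-maximal \<open>M\<close> is
  all of \<open>R\<close> or gr-maximal, so in both cases it contains the radical.
\<close>

lemma gr_radical_left_ideal:
  assumes u: "u \<in> gr_radical \<Gamma> R A" and "h \<in> carrier R"
  shows "h \<otimes> u \<in> gr_radical \<Gamma> R A"
  using assms(2)
proof (induction h rule: homogeneous_induct)
  have uc: "u \<in> carrier R" using u by (simp add: gr_radical_def)
  case zero
  then show ?case using uc mult_zero_left gri_zero gr_radical_gri by simp
  case (plus a b)
  then show ?case using uc l_distr gri_add gr_radical_gri by simp
next
  case (base g h)
  have uc: "u \<in> carrier R" using u by (simp add: gr_radical_def)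
  have "h \<otimes> u \<in> M" if M: "gr_maximal \<Gamma> R A M" for M
  proof (cases "{r \<in> carrier R. h \<otimes> r \<in> M} = carrier R")
    case False
    then show ?thesis using u gr_maximal_left_vimage[OF base M] by (auto simp: gr_radical_def)
  qed (use uc in blast)
  then show ?case using base grade_carrier uc m_closed by (auto simp: gr_radical_def)
qed

end

section \<open>Quotients by graded ideals\<close>

text \<open>
  For a graded two-sided ideal \<open>J\<close>, these are the inverse images of the gr-simple right ideals of
  the quotient by \<open>J\<close>.
\<close>

definition gr_minimal_over ::
    "('x, 'g) gpd \<Rightarrow> ('a, 'b) ring_scheme \<Rightarrow> ('g \<Rightarrow> 'a set) \<Rightarrow> 'a set \<Rightarrow> 'a set \<Rightarrow> bool" where
  "gr_minimal_over \<Gamma> R A J U \<longleftrightarrow>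
     graded_right_ideal \<Gamma> R A U \<and> J \<subseteq> U \<and> U \<noteq> J \<and>
     (\<forall>V. graded_right_ideal \<Gamma> R A V \<and> J \<subseteq> V \<and> V \<subseteq> U \<longrightarrow> V = J \<or> V = U)"

locale gr_ideal = graded_ring \<Gamma> R A
  for \<Gamma> :: "('x, 'g) gpd" and R :: "('a, 'b) ring_scheme" (structure) and A :: "'g \<Rightarrow> 'a set" +
  fixes J :: "'a set"
  assumes J_gri: "graded_right_ideal \<Gamma> R A J"
    and J_left: "\<lbrakk>u \<in> J; r \<in> carrier R\<rbrakk> \<Longrightarrow> r \<otimes> u \<in> J"

sublocale gr_ideal \<subseteq> J: abelian_subgroup J R
  by (rule abelian_subgroupI3[OF gri_subgroup[OF J_gri] abelian_group_axioms])

context gr_ideal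
begin

abbreviation "Q \<equiv> R Quot J"
abbreviation "proj \<equiv> \<lambda>r. J +> r"
abbreviation "quot_gri \<equiv> graded_right_ideal \<Gamma> Q (quot_grade R J A)"

lemma J_subset: "J \<subseteq> carrier R"
  by (rule gri_subset[OF J_gri])

lemma Q_abelian_group: "abelian_group Q"
  by (rule comm_group_abelian_groupI)
    (simp add: FactRing_def J.a_factorgroup_is_comm_group[unfolded A_FactGroup_def'])

lemma carrier_Q: "carrier Q = proj ` carrier R"
  by (auto simp: FactRing_def A_RCOSETS_def')

lemma Q_cases:
  assumes "x \<in> carrier Q"
  obtains r where "r \<in> carrier R" "x = proj r"
  using assms by (auto simp: carrier_Q)

lemma proj_closed: "r \<in> carrier R \<Longrightarrow> proj r \<in> carrier Q"
  by (simp add: carrier_Q)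

lemma proj_add:
  "\<lbrakk>r \<in> carrier R; s \<in> carrier R\<rbrakk> \<Longrightarrow> proj (r \<oplus> s) = proj r \<oplus>\<^bsub>Q\<^esub> proj s"
  by (simp add: FactRing_def J.a_rcos_sum)

lemma zero_Q: "\<zero>\<^bsub>Q\<^esub> = J"
  by (simp add: FactRing_def)

lemma proj_eq_zero_iff: "r \<in> carrier R \<Longrightarrow> proj r = \<zero>\<^bsub>Q\<^esub> \<longleftrightarrow> r \<in> J"
  unfolding zero_Q using J.a_rcos_const J.a_rcos_self by blast

lemma proj_mem_imageD:
  assumes "r \<in> carrier R" "proj r \<in> proj ` H" "additive_subgroup H R" "J \<subseteq> H"
  shows "r \<in> H"
proof -
  obtain v where v: "v \<in> H" "proj r = proj v" using assms by blast
  then have "r \<in> J +> v" using J.a_rcos_self[OF assms(1)] by simp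
  then obtain j where "j \<in> J" "r = j \<oplus> v" by (auto simp: a_r_coset_def')
  moreover have "j \<oplus> v \<in> H" if "j \<in> J" for j
    using that v assms(4) by (intro additive_subgroup.a_closed[OF assms(3)]) auto
  ultimately show ?thesis by simp
qed

lemma proj_eq_iff:
  assumes "r \<in> carrier R" "s \<in> carrier R"
  shows "proj r = proj s \<longleftrightarrow> (\<exists>j\<in>J. r = j \<oplus> s)"
proof
  assume "proj r = proj s"
  then have "r \<in> J +> s" using J.a_rcos_self[OF assms(1)] by simp
  then show "\<exists>j\<in>J. r = j \<oplus> s" by (auto simp: a_r_coset_def')
next
  assume "\<exists>j\<in>J. r = j \<oplus> s"
  then obtain j where j: "j \<in> J" "r = j \<oplus> s" by blast
  then have "proj r = proj j \<oplus>\<^bsub>Q\<^esub> proj s" using assms J_subset proj_add by auto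
  also have "proj j = \<zero>\<^bsub>Q\<^esub>" using j J_subset proj_eq_zero_iff by blast
  finally show "proj r = proj s"
    using abelian_group.axioms(1)[OF Q_abelian_group] proj_closed[OF assms(2)]
    by (simp add: abelian_monoid.l_zero)
qed

text \<open>
  This is the step that needs \<open>J\<close> to be a two-sided ideal.
\<close>

lemma proj_mult:
  assumes r: "r \<in> carrier R" and s: "s \<in> carrier R"
  shows "proj r \<otimes>\<^bsub>Q\<^esub> proj s = proj (r \<otimes> s)"
proof -
  have "proj (a \<otimes> b) = proj (r \<otimes> s)" if "a \<in> proj r" "b \<in> proj s" for a b
  proof -
    obtain i where i: "i \<in> J" "a = i \<oplus> r" using \<open>a \<in> proj r\<close> by (auto simp: a_r_coset_def')
    obtain j where j: "j \<in> J" "b = j \<oplus> s" using \<open>b \<in> proj s\<close> by (auto simp: a_r_coset_def')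
    have c: "i \<in> carrier R" "j \<in> carrier R" using i j J_subset by auto
    have "a \<otimes> b = (i \<otimes> (j \<oplus> s) \<oplus> r \<otimes> j) \<oplus> r \<otimes> s"
      using i j c r s by (simp add: l_distr r_distr m_closed a_ac)
    moreover have "i \<otimes> (j \<oplus> s) \<oplus> r \<otimes> j \<in> J"
      using i j c s r gri_mult[OF J_gri] J_left by (intro gri_add[OF J_gri]) auto
    moreover have "a \<in> carrier R" "b \<in> carrier R" using i j c r s by auto
    ultimately show ?thesis using proj_eq_iff r s m_closed by auto
  qed
  moreover have "r \<in> proj r" "s \<in> proj s" using r s J.a_rcos_self by auto
  ultimately have "(\<Union>a\<in>proj r. \<Union>b\<in>proj s. proj (a \<otimes> b)) = proj (r \<otimes> s)" by blast
  then show ?thesis by (simp add: FactRing_def rcoset_mult_def)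
qed

lemma Q_nonunital_ring: "nonunital_ring Q"
  using Q_abelian_group
  by (intro nonunital_ring.intro nonunital_ring_axioms.intro)
    (auto simp: carrier_Q proj_mult m_closed proj_add[symmetric] m_assoc l_distr r_distr)

lemma proj_finsum:
  assumes "finite K" "y \<in> K \<rightarrow> carrier R"
  shows "proj (finsum R y K) = finsum Q (\<lambda>k. proj (y k)) K"
proof -
  interpret Q: abelian_group Q by (rule Q_abelian_group)
  show ?thesis
    using assms
  proof (induction K rule: finite_induct)
    case empty
    have "proj \<zero> = \<zero>\<^bsub>Q\<^esub>" using proj_eq_zero_iff gri_zero[OF J_gri] by blast
    then show ?case by simp
  next
    case (insert k K)
    then have "y k \<in> carrier R" "y \<in> K \<rightarrow> carrier R" by auto
    moreover from this have "(\<lambda>k. proj (y k)) \<in> K \<rightarrow> carrier Q" using proj_closed by auto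
    ultimately show ?case using insert proj_closed
      by (simp add: Q.finsum_insert proj_add)
  qed
qed

lemma Q_graded_ring: "graded_ring \<Gamma> Q (quot_grade R J A)"
proof (intro graded_ring.intro graded_ring_axioms.intro groupoid_axioms Q_nonunital_ring)
  have ps: "additive_subgroup (proj ` H) Q" if "additive_subgroup H R" for H
    by (rule additive_subgroup_image)
      (use abelian_group_axioms Q_abelian_group proj_closed proj_add that in auto)
  show "internal_direct_sum Q (Garr \<Gamma>) (quot_grade R J A) (carrier Q)"
    unfolding internal_direct_sum_def
  proof (intro conjI ballI allI impI)
    show "additive_subgroup (quot_grade R J A \<gamma>) Q" if "\<gamma> \<in> Garr \<Gamma>" for \<gamma>
      unfolding quot_grade_def using that by (intro ps grade_subgroup)
    interpret Q: abelian_group Q by (rule Q_abelian_group)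
    let ?B = "\<Union>\<gamma>\<in>Garr \<Gamma>. quot_grade R J A \<gamma>"
    have B: "?B \<subseteq> carrier Q" using grade_carrier by (auto simp: quot_grade_def carrier_Q)
    have "proj r \<in> span Q ?B" if "r \<in> carrier R" for r
    proof -
      have "r \<in> {r \<in> carrier R. proj r \<in> span Q ?B}"
      proof (rule hcomp_recombine)
        show "additive_subgroup {r \<in> carrier R. proj r \<in> span Q ?B} R"
          by (rule additive_subgroup_vimage)
            (use abelian_group_axioms Q_abelian_group proj_closed proj_add B
              Q.span_additive_subgroup in auto)
        fix \<gamma> assume "\<gamma> \<in> Garr \<Gamma>"
        then show "hcomp \<gamma> r \<in> {r \<in> carrier R. proj r \<in> span Q ?B}"
          using that hcomp_carrier hcomp_in by (auto simp: quot_grade_def intro!: generate.incl)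
      qed (rule that)
      then show ?thesis by simp
    qed
    then show "carrier Q = span Q ?B"
      using Q.add.generate_incl[of ?B] B by (auto simp: carrier_Q)
    fix K x \<gamma>
    assume K: "finite K \<and> K \<subseteq> Garr \<Gamma> \<and> x \<in> (\<Pi> \<gamma>\<in>K. quot_grade R J A \<gamma>) \<and> finsum Q x K = \<zero>\<^bsub>Q\<^esub>"
      and \<gamma>: "\<gamma> \<in> K"
    have "\<forall>\<delta>\<in>K. \<exists>a\<in>A \<delta>. x \<delta> = proj a" using K by (fastforce simp: quot_grade_def Pi_iff)
    then obtain y where y: "\<And>\<delta>. \<delta> \<in> K \<Longrightarrow> y \<delta> \<in> A \<delta> \<and> x \<delta> = proj (y \<delta>)" by metis
    have yc: "y \<in> K \<rightarrow> carrier R" using y K grade_carrier by blast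
    have "finsum Q x K = finsum Q (\<lambda>\<delta>. proj (y \<delta>)) K"
      using y yc proj_closed by (intro Q.finsum_cong') auto
    then have "proj (finsum R y K) = \<zero>\<^bsub>Q\<^esub>" using proj_finsum K yc by metis
    then have "finsum R y K \<in> J" using proj_eq_zero_iff finsum_closed[OF yc] by blast
    moreover have "hcomp \<gamma> (finsum R y K) = y \<gamma>"
      using K y \<gamma> by (intro hcomp_finsum) auto
    ultimately have "y \<gamma> \<in> J" using gri_hcomp[OF J_gri] K \<gamma> by (metis subsetD)
    then show "x \<gamma> = \<zero>\<^bsub>Q\<^esub>" using y[OF \<gamma>] J_subset proj_eq_zero_iff by auto
  qed
qed (use grade_mult grade_mult_zero grade_carrier proj_eq_zero_iff gri_zero[OF J_gri]
  in \<open>fastforce simp: quot_grade_def proj_mult\<close>)+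

sublocale Q: graded_ring \<Gamma> Q "quot_grade R J A"
  by (rule Q_graded_ring)

lemma Q_hcomp:
  assumes \<gamma>: "\<gamma> \<in> Garr \<Gamma>" and "r \<in> carrier R"
  shows "Q.hcomp \<gamma> (proj r) = proj (hcomp \<gamma> r)"
  using assms(2)
proof (induction r rule: homogeneous_induct)
  have z: "proj \<zero> = \<zero>\<^bsub>Q\<^esub>" using proj_eq_zero_iff gri_zero[OF J_gri] by blast
  case zero
  then show ?case by (simp add: z hcomp_zero Q.hcomp_zero)
next
  have z: "proj \<zero> = \<zero>\<^bsub>Q\<^esub>" using proj_eq_zero_iff gri_zero[OF J_gri] by blast
  case (base \<delta> a)
  then have "proj a \<in> quot_grade R J A \<delta>" by (simp add: quot_grade_def)
  then show ?case using base z by (simp add: Q.hcomp_homogeneous hcomp_homogeneous)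
next
  case (plus a b)
  then show ?case using \<gamma> by (simp add: proj_add hcomp_add Q.hcomp_add proj_closed hcomp_carrier)
qed

lemma quot_gri_image:
  assumes V: "gri V"
  shows "quot_gri (proj ` V)"
proof (rule Q.griI)
  have Vc: "V \<subseteq> carrier R" using V gri_subset by blast
  show "additive_subgroup (proj ` V) Q"
    by (rule additive_subgroup_image)
      (use abelian_group_axioms Q_abelian_group proj_closed proj_add gri_subgroup V in auto)
  fix u assume "u \<in> proj ` V"
  then obtain v where v: "u = proj v" "v \<in> V" "v \<in> carrier R" using Vc by blast
  show "u \<otimes>\<^bsub>Q\<^esub> r \<in> proj ` V" if "r \<in> carrier Q" for r
    using that v gri_mult[OF V] by (auto simp: carrier_Q proj_mult)
  show "Q.hcomp \<gamma> u \<in> proj ` V" if "\<gamma> \<in> Garr \<Gamma>" for \<gamma>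
    using that v gri_hcomp[OF V] by (simp add: Q_hcomp)
qed

definition lift :: "'a set set \<Rightarrow> 'a set" where
  "lift U = {r \<in> carrier R. proj r \<in> U}"

lemma gri_vimage:
  assumes U: "quot_gri U"
  shows "gri (lift U)"
  unfolding lift_def
proof (rule griI)
  show "additive_subgroup {r \<in> carrier R. proj r \<in> U} R"
    by (rule additive_subgroup_vimage)
      (use abelian_group_axioms Q_abelian_group proj_closed proj_add Q.gri_subgroup U in auto)
  fix u assume u: "u \<in> {r \<in> carrier R. proj r \<in> U}"
  show "u \<otimes> r \<in> {r \<in> carrier R. proj r \<in> U}" if "r \<in> carrier R" for r
    using that u Q.gri_mult[OF U] by (auto simp: proj_mult[symmetric] m_closed proj_closed)
  show "hcomp \<gamma> u \<in> {r \<in> carrier R. proj r \<in> U}" if "\<gamma> \<in> Garr \<Gamma>" for \<gamma>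
    using that u Q.gri_hcomp[OF U] by (auto simp: Q_hcomp[symmetric] hcomp_carrier)
qed

lemma subset_vimage:
  assumes U: "quot_gri U"
  shows "J \<subseteq> lift U"
proof
  fix j assume "j \<in> J"
  then show "j \<in> lift U"
    using J_subset proj_eq_zero_iff[of j] Q.gri_zero[OF U] by (auto simp: lift_def)
qed

lemma image_vimage: "quot_gri U \<Longrightarrow> proj ` lift U = U"
  using Q.gri_subset[of U] unfolding carrier_Q lift_def by blast

lemma vimage_image:
  "\<lbrakk>gri V; J \<subseteq> V\<rbrakk> \<Longrightarrow> lift (proj ` V) = V"
  using gri_subset[of V] proj_mem_imageD[OF _ _ gri_subgroup[of V]] unfolding lift_def by blast

lemma vimage_zero: "lift {\<zero>\<^bsub>Q\<^esub>} = J"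
  using proj_eq_zero_iff J_subset by (auto simp: lift_def)

lemma gr_simple_image:
  assumes V: "gr_minimal_over \<Gamma> R A J V"
  shows "gr_simple \<Gamma> Q (quot_grade R J A) (proj ` V)"
  unfolding gr_simple_def
proof (intro conjI allI impI)
  have Vg: "gri V" "J \<subseteq> V" "V \<noteq> J" using V by (auto simp: gr_minimal_over_def)
  show "quot_gri (proj ` V)" using quot_gri_image Vg by blast
  show "proj ` V \<noteq> {\<zero>\<^bsub>Q\<^esub>}" using vimage_image[OF Vg(1,2)] vimage_zero Vg(3) by metis
  fix U assume U: "quot_gri U \<and> U \<subseteq> proj ` V"
  let ?W = "lift U"
  have "gri ?W" "J \<subseteq> ?W" using U gri_vimage subset_vimage by blast+
  moreover have "?W \<subseteq> V"
    using U vimage_image[OF Vg(1,2)] unfolding lift_def by blast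
  ultimately have "?W = J \<or> ?W = V" using V unfolding gr_minimal_over_def by blast
  then have "proj ` ?W = proj ` J \<or> proj ` ?W = proj ` V" by metis
  moreover have "proj ` J = {\<zero>\<^bsub>Q\<^esub>}"
    using proj_eq_zero_iff J_subset gri_zero[OF J_gri] by blast
  ultimately show "U = {\<zero>\<^bsub>Q\<^esub>} \<or> U = proj ` V" using image_vimage U by simp
qed

lemma gr_minimal_over_vimage:
  assumes U: "gr_simple \<Gamma> Q (quot_grade R J A) U"
  shows "gr_minimal_over \<Gamma> R A J (lift U)" (is "gr_minimal_over \<Gamma> R A J ?W")
  unfolding gr_minimal_over_def
proof (intro conjI allI impI)
  have Ug: "quot_gri U" "U \<noteq> {\<zero>\<^bsub>Q\<^esub>}" using U by (auto simp: gr_simple_def)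
  have pJ: "proj ` J = {\<zero>\<^bsub>Q\<^esub>}"
    using proj_eq_zero_iff J_subset gri_zero[OF J_gri] by blast
  show "gri ?W" "J \<subseteq> ?W" using Ug gri_vimage subset_vimage by blast+
  show "?W \<noteq> J" using image_vimage[OF Ug(1)] pJ Ug(2) by metis
  fix V assume V: "gri V \<and> J \<subseteq> V \<and> V \<subseteq> ?W"
  then have "quot_gri (proj ` V)" "proj ` V \<subseteq> U"
    using quot_gri_image by (auto simp: lift_def)
  then have "proj ` V = {\<zero>\<^bsub>Q\<^esub>} \<or> proj ` V = U" using U unfolding gr_simple_def by blast
  then show "V = J \<or> V = ?W" using vimage_image[of V] V vimage_zero by metis
qed

lemma Q_span_image:
  assumes "\<And>V. V \<in> F \<Longrightarrow> gri V" and "carrier R = span R (J \<union> \<Union>F)"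
  shows "carrier Q = ideal_sum Q ((`) proj ` F)"
proof -
  let ?S = "span Q (\<Union>((`) proj ` F))"
  have sub: "\<Union>((`) proj ` F) \<subseteq> carrier Q"
    using gri_subset[OF assms(1)] proj_closed by blast
  then have S: "additive_subgroup ?S Q" by (rule Q.span_additive_subgroup)
  have "proj r \<in> ?S" if "r \<in> carrier R" for r
  proof (rule span_map[of Q proj _ "J \<union> \<Union>F"])
    show "J \<union> \<Union>F \<subseteq> carrier R" using gri_subset[OF assms(1)] J_subset by blast
    show "r \<in> span R (J \<union> \<Union>F)" using that assms(2) by simp
    fix b assume "b \<in> J \<union> \<Union>F"
    then show "proj b \<in> ?S"
    proof
      assume "b \<in> J"
      then have "proj b = \<zero>\<^bsub>Q\<^esub>" using proj_eq_zero_iff J_subset by blast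
      then show ?thesis using additive_subgroup.zero_closed[OF S] by (simp only:)
    qed (auto intro: generate.incl)
  qed (use Q_abelian_group proj_closed proj_add S in auto)
  then have "carrier Q \<subseteq> ?S" by (auto elim: Q_cases)
  then show ?thesis
    using additive_subgroup.a_subset[OF S] unfolding ideal_sum_def by (rule equalityI)
qed

lemma span_vimage:
  assumes "\<And>U. U \<in> F \<Longrightarrow> quot_gri U" and "carrier Q = ideal_sum Q F"
  shows "carrier R = span R (J \<union> \<Union>(lift ` F))" (is "_ = span R ?B")
proof -
  have B: "?B \<subseteq> carrier R" using J_subset by (auto simp: lift_def)
  then have S: "additive_subgroup (span R ?B) R" by (rule span_additive_subgroup)
  have pS: "additive_subgroup (proj ` span R ?B) Q"
    by (rule additive_subgroup_image)
      (use abelian_group_axioms Q_abelian_group proj_closed proj_add S in auto)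
  have "\<Union>F \<subseteq> proj ` span R ?B"
  proof
    fix u assume "u \<in> \<Union>F"
    then obtain U where U: "U \<in> F" "u \<in> U" by blast
    then have "u \<in> carrier Q" using Q.gri_subset[OF assms(1)] by blast
    then obtain r where r: "r \<in> carrier R" "u = proj r" by (rule Q_cases)
    then have "r \<in> ?B" using U by (auto simp: lift_def)
    then show "u \<in> proj ` span R ?B" unfolding r(2) by (intro imageI generate.incl)
  qed
  then have "carrier Q \<subseteq> proj ` span R ?B"
    using assms(2)[unfolded ideal_sum_def] Q.span_in_subgroup[OF pS] ord_eq_le_trans by blast
  then have im: "proj r \<in> proj ` span R ?B" if "r \<in> carrier R" for r
    using proj_closed[OF that] by (rule subsetD)
  have "J \<subseteq> span R ?B" by (intro subsetI generate.incl UnI1)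
  then have "carrier R \<subseteq> span R ?B"
    using proj_mem_imageD[OF _ im S] by (intro subsetI)
  then show ?thesis using additive_subgroup.a_subset[OF S] by (rule equalityI)
qed

lemma gr_semisimple_quotient_iff:
  "gr_semisimple \<Gamma> Q (quot_grade R J A) \<longleftrightarrow>
     (\<exists>F. (\<forall>U\<in>F. gr_minimal_over \<Gamma> R A J U) \<and> carrier R = span R (J \<union> \<Union>F))"
proof
  assume "gr_semisimple \<Gamma> Q (quot_grade R J A)"
  then obtain F where F: "\<forall>U\<in>F. gr_simple \<Gamma> Q (quot_grade R J A) U" "carrier Q = ideal_sum Q F"
    by (auto simp: gr_semisimple_def)
  then have "\<And>U. U \<in> F \<Longrightarrow> quot_gri U" by (auto simp: gr_simple_def)
  with F show "\<exists>F. (\<forall>U\<in>F. gr_minimal_over \<Gamma> R A J U) \<and> carrier R = span R (J \<union> \<Union>F)"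
    using gr_minimal_over_vimage span_vimage
    by (intro exI[of _ "lift ` F"]) blast
next
  assume "\<exists>F. (\<forall>U\<in>F. gr_minimal_over \<Gamma> R A J U) \<and> carrier R = span R (J \<union> \<Union>F)"
  then obtain F where F: "\<forall>U\<in>F. gr_minimal_over \<Gamma> R A J U" "carrier R = span R (J \<union> \<Union>F)" by blast
  then have "\<And>U. U \<in> F \<Longrightarrow> gri U" by (auto simp: gr_minimal_over_def)
  then show "gr_semisimple \<Gamma> Q (quot_grade R J A)"
    unfolding gr_semisimple_def using F gr_simple_image Q_span_image Q_graded_ring
    by (intro conjI exI[of _ "(`) proj ` F"]) blast+
qed

end

context graded_ring
begin

lemma gr_radical_gr_ideal: "gr_ideal \<Gamma> R A (gr_radical \<Gamma> R A)"
  by unfold_locales (simp_all add: gr_radical_gri gr_radical_left_ideal)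

text \<open>
  The quotient is eliminated here once and for all: both sums of gr-simple ideals in \<open>R/J\<close> and
  gr-simplicity itself are lifted along the projection.
\<close>

theorem gr_semilocal_iff:
  "gr_semilocal \<Gamma> R A \<longleftrightarrow>
     (\<exists>F. (\<forall>U\<in>F. gr_minimal_over \<Gamma> R A (gr_radical \<Gamma> R A) U) \<and>
       carrier R = span R (gr_radical \<Gamma> R A \<union> \<Union>F))"
  using gr_ideal.gr_semisimple_quotient_iff[OF gr_radical_gr_ideal] graded_ring_axioms
  by (simp add: gr_semilocal_def)

end

section \<open>Ungraded rings as trivially graded rings\<close>

definition minimal_over :: "('a, 'b) ring_scheme \<Rightarrow> 'a set \<Rightarrow> 'a set \<Rightarrow> bool" where
  "minimal_over E J U \<longleftrightarrow>
     right_ideal E U \<and> J \<subseteq> U \<and> U \<noteq> J \<and>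
     (\<forall>V. right_ideal E V \<and> J \<subseteq> V \<and> V \<subseteq> U \<longrightarrow> V = J \<or> V = U)"

abbreviation "one_gpd \<equiv> pair_groupoid {()}"

text \<open>
  Over the groupoid with a single arrow every right ideal is graded, so that each graded notion
  becomes the ungraded one and the results above apply to an ordinary ring.
\<close>

lemma trivially_graded_ring:
  assumes "ring E"
  shows "graded_ring one_gpd E (\<lambda>_. carrier E)"
proof -
  interpret ring E by fact
  have eq: "(\<Union>i\<in>Garr one_gpd. carrier E) = carrier E" "span E (carrier E) = carrier E"
    using add.generate_incl[of "carrier E"] by (auto simp: pair_groupoid_def intro: generate.incl)
  have s: "additive_subgroup (carrier E) E"
    by (intro additive_subgroup.intro add.subgroup_self)
  have "internal_direct_sum E (Garr one_gpd) (\<lambda>_. carrier E) (carrier E)"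
    unfolding internal_direct_sum_def eq
  proof (intro conjI ballI allI impI s refl)
    fix J x i
    assume J: "finite J \<and> J \<subseteq> Garr one_gpd \<and> x \<in> J \<rightarrow> carrier E \<and> finsum E x J = \<zero>\<^bsub>E\<^esub>" and i: "i \<in> J"
    then have "J = {i}" by (auto simp: pair_groupoid_def)
    then show "x i = \<zero>\<^bsub>E\<^esub>" using J by auto
  qed
  then show ?thesis
    by (intro graded_ring.intro graded_ring_axioms.intro nonunital_ring.intro
        nonunital_ring_axioms.intro pair_groupoid_is_groupoid abelian_group_axioms)
      (auto simp: pair_groupoid_def l_distr r_distr m_assoc)
qed

lemma trivially_graded_right_ideal:
  assumes "ring E"
  shows "graded_right_ideal one_gpd E (\<lambda>_. carrier E) U \<longleftrightarrow> right_ideal E U"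
proof -
  interpret graded_ring one_gpd E "\<lambda>_. carrier E" by (rule trivially_graded_ring[OF assms])
  have "hcomp \<gamma> u = u" if "\<gamma> \<in> Garr one_gpd" "u \<in> carrier E" for \<gamma> u
    using hcomp_homogeneous[OF that] by simp
  then show ?thesis
    using additive_subgroup.a_subset[of U E]
    unfolding graded_right_ideal_iff right_ideal_def by (metis subsetD)
qed

lemma trivial_gr_radical:
  assumes "ring E"
  shows "gr_radical one_gpd E (\<lambda>_. carrier E) = jacobson_radical E"
  unfolding gr_radical_def jacobson_radical_def gr_maximal_def maximal_right_ideal_def
  by (simp add: trivially_graded_right_ideal[OF assms])

lemma jacobson_radical_ideal:
  assumes "ring E"
  shows "ideal (jacobson_radical E) E"
proof -
  interpret ring E by fact
  interpret G: gr_ideal one_gpd E "\<lambda>_. carrier E" "jacobson_radical E"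
    unfolding trivial_gr_radical[OF assms, symmetric]
    by (rule graded_ring.gr_radical_gr_ideal[OF trivially_graded_ring[OF assms]])
  show ?thesis
    by (intro ideal.intro ideal_axioms.intro ring_axioms G.J.additive_subgroup_axioms
        G.J_left G.gri_mult[OF G.J_gri])
qed

lemma semilocal_ring_iff:
  assumes "ring E"
  shows "semilocal_ring E \<longleftrightarrow>
     (\<exists>F. (\<forall>U\<in>F. minimal_over E (jacobson_radical E) U) \<and>
       carrier E = span E (jacobson_radical E \<union> \<Union>F))"
proof -
  let ?J = "jacobson_radical E" and ?A = "\<lambda>_. carrier E"
  have Q: "ring (E Quot ?J)" by (rule ideal.quotient_is_ring[OF jacobson_radical_ideal[OF assms]])
  have g: "quot_grade E ?J (\<lambda>_. carrier E) = (\<lambda>_. carrier (E Quot ?J))"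
    by (auto simp: quot_grade_def FactRing_def A_RCOSETS_def' fun_eq_iff)
  have "gr_semilocal one_gpd E ?A \<longleftrightarrow> gr_semisimple one_gpd (E Quot ?J) (\<lambda>_. carrier (E Quot ?J))"
    using trivially_graded_ring[OF assms]
    by (simp only: gr_semilocal_def trivial_gr_radical[OF assms] g simp_thms)
  also have "\<dots> \<longleftrightarrow> semilocal_ring E"
    using assms Q trivially_graded_ring[OF Q]
    unfolding gr_semisimple_def semilocal_ring_def semisimple_ring_def gr_simple_def
      simple_right_ideal_def trivially_graded_right_ideal[OF Q] by blast
  finally show ?thesis
    unfolding graded_ring.gr_semilocal_iff[OF trivially_graded_ring[OF assms]]
      trivial_gr_radical[OF assms] gr_minimal_over_def minimal_over_def
      trivially_graded_right_ideal[OF assms] by blast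
qed

lemma right_ideal_Inter:
  assumes "ring E" "\<And>M. M \<in> \<M> \<Longrightarrow> right_ideal E M"
  shows "right_ideal E (carrier E \<inter> \<Inter>\<M>)"
  using graded_ring.gri_Inter[OF trivially_graded_ring[OF assms(1)]] assms
  by (simp add: trivially_graded_right_ideal)

lemma right_ideal_jacobson_radical: "ring E \<Longrightarrow> right_ideal E (jacobson_radical E)"
  unfolding jacobson_radical_def by (rule right_ideal_Inter) (auto simp: maximal_right_ideal_def)

section \<open>Right ideals of a corner ring\<close>

text \<open>
  The ring \<open>E\<close> is identified with \<open>A (x, x)\<close> through \<open>\<phi>\<close> instead of being a subset of \<open>R\<close>; in this
  form the endomorphism ring of an object is a corner without transport of structure. The last two
  assumptions say that the identity of \<open>E\<close> is a local unit for row and column \<open>x\<close>.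
\<close>

locale corner = graded_ring "pair_groupoid I" R A
  for I :: "'o set" and R :: "('a, 'b) ring_scheme" (structure) and A :: "'o \<times> 'o \<Rightarrow> 'a set" +
  fixes E :: "('e, 'f) ring_scheme" and x :: 'o and \<phi> :: "'e \<Rightarrow> 'a"
  assumes E_ring: "ring E" and x: "x \<in> I"
    and \<phi>_bij: "bij_betw \<phi> (carrier E) (A (x, x))"
    and \<phi>_add: "\<lbrakk>a \<in> carrier E; b \<in> carrier E\<rbrakk> \<Longrightarrow> \<phi> (a \<oplus>\<^bsub>E\<^esub> b) = \<phi> a \<oplus> \<phi> b"
    and \<phi>_mult: "\<lbrakk>a \<in> carrier E; b \<in> carrier E\<rbrakk> \<Longrightarrow> \<phi> (a \<otimes>\<^bsub>E\<^esub> b) = \<phi> a \<otimes> \<phi> b"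
    and unit_left: "\<lbrakk>y \<in> I; r \<in> A (x, y)\<rbrakk> \<Longrightarrow> \<phi> \<one>\<^bsub>E\<^esub> \<otimes> r = r"
    and unit_right: "\<lbrakk>y \<in> I; r \<in> A (y, x)\<rbrakk> \<Longrightarrow> r \<otimes> \<phi> \<one>\<^bsub>E\<^esub> = r"
begin

interpretation E: ring E by (rule E_ring)

lemma arr: "(u, v) \<in> Garr (pair_groupoid I) \<longleftrightarrow> u \<in> I \<and> v \<in> I"
  by (simp add: pair_groupoid_def)

lemma pg_simps [simp]: "Gsrc (pair_groupoid I) = snd" "Gtgt (pair_groupoid I) = fst"
  "Gmul (pair_groupoid I) g h = (fst g, snd h)"
  by (simp_all add: pair_groupoid_def)

lemma \<phi>_grade: "a \<in> carrier E \<Longrightarrow> \<phi> a \<in> A (x, x)"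
  using \<phi>_bij by (auto simp: bij_betw_def)

lemma \<phi>_carrier: "a \<in> carrier E \<Longrightarrow> \<phi> a \<in> carrier R"
  using \<phi>_grade grade_carrier x by (auto simp: arr)

lemma \<phi>_surj:
  assumes "r \<in> A (x, x)"
  obtains a where "a \<in> carrier E" "r = \<phi> a"
  using assms \<phi>_bij by (auto simp: bij_betw_def)

lemma \<phi>_mem_image_iff: "\<lbrakk>a \<in> carrier E; N \<subseteq> carrier E\<rbrakk> \<Longrightarrow> \<phi> a \<in> \<phi> ` N \<longleftrightarrow> a \<in> N"
  using \<phi>_bij by (auto simp: bij_betw_def inj_on_def)

abbreviation diag :: "'a \<Rightarrow> 'a" where
  "diag \<equiv> hcomp (x, x)"

lemma diag_grade: "r \<in> carrier R \<Longrightarrow> diag r \<in> A (x, x)"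
  by (rule hcomp_in) (simp_all add: arr x)

lemma diag_row:
  assumes "y \<in> I" "a \<in> A (x, y)" "s \<in> carrier R"
  shows "diag (a \<otimes> s) = a \<otimes> hcomp (y, x) s"
  using hcomp_mult_left[of "(x, y)" a "(y, x)" s] assms x by (simp add: arr)

lemma diag_off_row:
  assumes "u \<in> I" "y \<in> I" "u \<noteq> x" "a \<in> A (u, y)" "s \<in> carrier R"
  shows "diag (a \<otimes> s) = \<zero>"
  using assms(5)
proof (induction s rule: homogeneous_induct)
  have a: "a \<in> carrier R" using assms grade_carrier arr by blast
  case zero then show ?case using a by (simp add: mult_zero_right hcomp_zero)
  case (plus s t) then show ?case using a by (simp add: r_distr m_closed hcomp_add)
next
  case (base \<gamma> s)
  obtain v w where \<gamma>: "\<gamma> = (v, w)" by (cases \<gamma>)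
  have g: "(u, y) \<in> Garr (pair_groupoid I)" "v \<in> I" "w \<in> I" using assms base \<gamma> by (auto simp: arr)
  show ?case
  proof (cases "v = y")
    case True
    then have "a \<otimes> s \<in> A (u, w)" using grade_mult[OF g(1) base(1) assms(4) base(2)] \<gamma> by simp
    then show ?thesis using hcomp_homogeneous[of "(u, w)"] assms g by (simp add: arr)
  next
    case False
    then have "a \<otimes> s = \<zero>" using grade_mult_zero[OF g(1) base(1) assms(4) base(2)] \<gamma> by simp
    then show ?thesis by (simp add: hcomp_zero)
  qed
qed

lemma diag_column:
  assumes "y \<in> I" "a \<in> A (y, x)" "r \<in> carrier R"
  shows "diag (r \<otimes> a) = hcomp (x, y) r \<otimes> a"
  using assms(3)
proof (induction r rule: homogeneous_induct)
  have a: "a \<in> carrier R" using assms grade_carrier arr x by blast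
  case zero then show ?case using a by (simp add: mult_zero_left hcomp_zero)
  case (plus s t)
  then show ?case using a assms x by (simp add: l_distr m_closed hcomp_add hcomp_carrier arr)
next
  have a: "a \<in> carrier R" using assms grade_carrier arr x by blast
  case (base \<gamma> r)
  obtain v w where \<gamma>: "\<gamma> = (v, w)" by (cases \<gamma>)
  have g: "(y, x) \<in> Garr (pair_groupoid I)" "v \<in> I" "w \<in> I" using assms base \<gamma> x by (auto simp: arr)
  show ?case
  proof (cases "w = y")
    case True
    then have "r \<otimes> a \<in> A (v, x)" using grade_mult[OF base(1) g(1) base(2) assms(2)] \<gamma> by simp
    then show ?thesis
      using hcomp_homogeneous[of "(v, x)"] hcomp_homogeneous[OF base] g True \<gamma> a x
      by (simp add: arr mult_zero_left)
  next
    case False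
    then have "r \<otimes> a = \<zero>" using grade_mult_zero[OF base(1) g(1) base(2) assms(2)] \<gamma> by simp
    then show ?thesis using hcomp_homogeneous[OF base] False \<gamma> a by (simp add: hcomp_zero mult_zero_left)
  qed
qed

definition res :: "'a set \<Rightarrow> 'e set" where
  "res U = {a \<in> carrier E. \<phi> a \<in> U}"

text \<open>
  As only the component in row \<open>x\<close> of \<open>r\<close> contributes to the entry \<open>(x, x)\<close> of \<open>r s\<close>, this consists
  of the \<open>r\<close> whose row \<open>x\<close> is mapped into \<open>N\<close> by everything that maps it back into the corner. In
  terms of a category, these are the morphisms \<open>f\<close> into \<open>x\<close> with \<open>f g \<in> N\<close> for all \<open>g\<close> out of \<open>x\<close>.
\<close>

definition coind :: "'e set \<Rightarrow> 'a set" where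
  "coind N = {r \<in> carrier R. \<forall>s\<in>carrier R. diag (r \<otimes> s) \<in> \<phi> ` N}"

lemma right_ideal_subset: "right_ideal E N \<Longrightarrow> N \<subseteq> carrier E"
  unfolding right_ideal_def using additive_subgroup.a_subset by blast

lemma res_right_ideal:
  assumes "gri U"
  shows "right_ideal E (res U)"
  unfolding right_ideal_def
proof (intro conjI ballI)
  show "additive_subgroup (res U) E"
    unfolding res_def
    by (rule additive_subgroup_vimage)
      (use E.abelian_group_axioms abelian_group_axioms \<phi>_carrier \<phi>_add gri_subgroup assms in auto)
  fix u r assume "u \<in> res U" "r \<in> carrier E"
  then show "u \<otimes>\<^bsub>E\<^esub> r \<in> res U"
    using gri_mult[OF assms] by (simp add: res_def \<phi>_mult \<phi>_carrier)
qed

lemma image_subgroup: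
  assumes "right_ideal E N"
  shows "additive_subgroup (\<phi> ` N) R"
  by (rule additive_subgroup_image)
    (use assms E.abelian_group_axioms abelian_group_axioms \<phi>_carrier \<phi>_add in \<open>auto simp: right_ideal_def\<close>)

lemma image_zero: "right_ideal E N \<Longrightarrow> \<zero> \<in> \<phi> ` N"
  by (rule additive_subgroup.zero_closed[OF image_subgroup])

text \<open>
  For gradedness, the \<open>(v, w)\<close>-component of \<open>u\<close> is either invisible to \<^term>\<open>diag\<close>, when \<open>v \<noteq> x\<close>, or its
  product with \<open>s\<close> has the same diagonal entry as \<open>u\<close> times the \<open>(w, x)\<close>-component of \<open>s\<close>.
\<close>

lemma coind_gri:
  assumes N: "right_ideal E N"
  shows "gri (coind N)"
proof (rule griI)
  note S = image_subgroup[OF N]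
  have sub: "additive_subgroup {r \<in> carrier R. diag (r \<otimes> s) \<in> \<phi> ` N} R" if "s \<in> carrier R" for s
    by (rule additive_subgroup_vimage)
      (use that S abelian_group_axioms in
        \<open>auto simp: m_closed l_distr hcomp_add hcomp_carrier arr x\<close>)
  show "additive_subgroup (coind N) R"
  proof (intro additive_subgroup.intro add.subgroupI)
    have "\<zero> \<in> coind N"
      using image_zero[OF N] by (simp add: coind_def mult_zero_left hcomp_zero)
    then show "coind N \<noteq> {}" by blast
    show "\<ominus> a \<in> coind N" if "a \<in> coind N" for a
      using that additive_subgroup.a_inv_closed[OF sub] unfolding coind_def by blast
    show "a \<oplus> b \<in> coind N" if "a \<in> coind N" "b \<in> coind N" for a b
      using that additive_subgroup.a_closed[OF sub] unfolding coind_def by blast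
  qed (simp add: coind_def)
  fix u assume u: "u \<in> coind N"
  then have uc: "u \<in> carrier R" by (simp add: coind_def)
  show "u \<otimes> r \<in> coind N" if "r \<in> carrier R" for r
    using u that by (simp add: coind_def m_closed m_assoc)
  show "hcomp \<gamma> u \<in> coind N" if \<gamma>: "\<gamma> \<in> Garr (pair_groupoid I)" for \<gamma>
  proof -
    obtain v w where vw: "\<gamma> = (v, w)" "v \<in> I" "w \<in> I" using \<gamma> by (cases \<gamma>) (simp add: arr)
    have h: "hcomp \<gamma> u \<in> A (v, w)" using hcomp_in[OF uc \<gamma>] vw by simp
    have "diag (hcomp \<gamma> u \<otimes> s) \<in> \<phi> ` N" if s: "s \<in> carrier R" for s
    proof (cases "v = x")
      case True
      have sx: "hcomp (w, x) s \<in> A (w, x)" "hcomp (w, x) s \<in> carrier R"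
        using hcomp_in hcomp_carrier s vw x by (auto simp: arr)
      have "diag (hcomp \<gamma> u \<otimes> s) = hcomp \<gamma> u \<otimes> hcomp (w, x) s"
        using diag_row[OF vw(3) _ s] h True by simp
      also have "\<dots> = diag (u \<otimes> hcomp (w, x) s)"
        using diag_column[OF vw(3) sx(1) uc] vw True by simp
      finally show ?thesis using u sx(2) by (simp add: coind_def)
    next
      case False
      then show ?thesis using diag_off_row[OF vw(2,3) _ h s] image_zero[OF N] by simp
    qed
    then show ?thesis using hcomp_carrier[OF uc \<gamma>] by (simp add: coind_def)
  qed
qed

lemma res_coind:
  assumes N: "right_ideal E N"
  shows "res (coind N) = N"
proof (intro equalityI subsetI)
  note Nc = right_ideal_subset[OF N]
  fix a assume "a \<in> res (coind N)"
  then have a: "a \<in> carrier E" "\<phi> a \<in> coind N" by (auto simp: res_def)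
  then have "diag (\<phi> a \<otimes> \<phi> \<one>\<^bsub>E\<^esub>) \<in> \<phi> ` N" using \<phi>_carrier by (simp add: coind_def)
  moreover have "diag (\<phi> a \<otimes> \<phi> \<one>\<^bsub>E\<^esub>) = \<phi> a"
    using unit_right[OF x \<phi>_grade[OF a(1)]] hcomp_homogeneous[OF _ \<phi>_grade[OF a(1)]] x
    by (simp add: arr)
  ultimately show "a \<in> N" using \<phi>_mem_image_iff a Nc by simp
next
  note Nc = right_ideal_subset[OF N]
  fix a assume a: "a \<in> N"
  then have ac: "a \<in> carrier E" using Nc by blast
  have "diag (\<phi> a \<otimes> s) \<in> \<phi> ` N" if s: "s \<in> carrier R" for s
  proof -
    obtain b where b: "b \<in> carrier E" "diag s = \<phi> b" using \<phi>_surj[OF diag_grade[OF s]] by blast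
    have "diag (\<phi> a \<otimes> s) = \<phi> (a \<otimes>\<^bsub>E\<^esub> b)"
      using diag_row[OF x \<phi>_grade[OF ac] s] b ac by (simp add: \<phi>_mult)
    then show ?thesis using N a b by (simp add: right_ideal_def)
  qed
  then show "a \<in> res (coind N)" using ac by (simp add: res_def coind_def \<phi>_carrier)
qed

lemma subset_coind_res:
  assumes U: "gri U"
  shows "U \<subseteq> coind (res U)"
proof
  fix u assume u: "u \<in> U"
  then have uc: "u \<in> carrier R" using gri_subset[OF U] by blast
  have "diag (u \<otimes> s) \<in> \<phi> ` res U" if s: "s \<in> carrier R" for s
  proof -
    have "diag (u \<otimes> s) \<in> U" using u s U by (intro gri_hcomp gri_mult) (simp_all add: arr x)
    moreover obtain b where "b \<in> carrier E" "diag (u \<otimes> s) = \<phi> b"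
      using \<phi>_surj[OF diag_grade[OF m_closed[OF uc s]]] by blast
    ultimately show ?thesis by (auto simp: res_def)
  qed
  then show "u \<in> coind (res U)" using uc by (simp add: coind_def)
qed

lemma res_mono: "U \<subseteq> V \<Longrightarrow> res U \<subseteq> res V"
  by (auto simp: res_def)

lemma coind_mono: "M \<subseteq> N \<Longrightarrow> coind M \<subseteq> coind N"
  unfolding coind_def by blast

lemma coind_off_row:
  assumes "right_ideal E N" "u \<in> I" "y \<in> I" "u \<noteq> x" "a \<in> A (u, y)"
  shows "a \<in> coind N"
  using diag_off_row[OF assms(2-5)] image_zero[OF assms(1)] grade_carrier[OF _ assms(5)] assms
  by (simp add: coind_def arr)

text \<open>
  A graded right ideal that restricts to all of \<open>E\<close> contains the local unit, hence all of row \<open>x\<close>.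
\<close>

lemma row_subset:
  assumes "gri U" "res U = carrier E" "y \<in> I" "r \<in> A (x, y)"
  shows "r \<in> U"
proof -
  have "\<phi> \<one>\<^bsub>E\<^esub> \<in> U" using assms(2) E.one_closed unfolding res_def by blast
  then have "\<phi> \<one>\<^bsub>E\<^esub> \<otimes> r \<in> U" using assms grade_carrier x by (intro gri_mult) (auto simp: arr)
  then show ?thesis using unit_left assms by simp
qed

lemma coind_proper: "\<lbrakk>right_ideal E N; N \<noteq> carrier E\<rbrakk> \<Longrightarrow> coind N \<noteq> carrier R"
  using res_coind \<phi>_carrier by (auto simp: res_def)

text \<open>
  For every proper \<open>N\<close> above \<open>res M\<close>, the proper ideal \<open>coind N\<close> contains \<open>coind (res M)\<close>, hence
  \<open>M\<close>, hence equals \<open>M\<close>; restricting gives \<open>N = res M\<close>.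
\<close>

lemma res_gr_maximal:
  assumes M: "gr_maximal (pair_groupoid I) R A M" and "res M \<noteq> carrier E"
  shows "maximal_right_ideal E (res M)" "coind (res M) = M"
proof -
  have Mg: "gri M" using M by (simp add: gr_maximal_def)
  have eq: "coind N = M" if "right_ideal E N" "res M \<subseteq> N" "N \<noteq> carrier E" for N
  proof -
    have "M \<subseteq> coind N" using subset_coind_res[OF Mg] coind_mono[OF that(2)] by blast
    moreover have "gri (coind N)" "coind N \<noteq> carrier R"
      using coind_gri[OF that(1)] coind_proper[OF that(1,3)] by auto
    ultimately show ?thesis using M unfolding gr_maximal_def by blast
  qed
  show "maximal_right_ideal E (res M)"
    unfolding maximal_right_ideal_def
  proof (intro conjI allI impI res_right_ideal[OF Mg] assms(2))
    fix N assume N: "right_ideal E N \<and> res M \<subseteq> N \<and> N \<noteq> carrier E"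
    then have "coind N = M" by (intro eq) auto
    then show "N = res M" using res_coind[of N] N by simp
  qed
  show "coind (res M) = M" by (rule eq[OF res_right_ideal[OF Mg] subset_refl assms(2)])
qed

text \<open>
  A larger \<open>U\<close> that restricts to \<open>N\<close> lies in \<open>coind N\<close> again. If it restricts to \<open>E\<close>, it contains
  row \<open>x\<close>, and it contains the other rows because \<open>coind N\<close> does.
\<close>

lemma coind_gr_maximal:
  assumes N: "maximal_right_ideal E N"
  shows "gr_maximal (pair_groupoid I) R A (coind N)"
  unfolding gr_maximal_def
proof (intro conjI allI impI)
  have Nr: "right_ideal E N" "N \<noteq> carrier E" using N by (auto simp: maximal_right_ideal_def)
  show "gri (coind N)" "coind N \<noteq> carrier R" using Nr coind_gri coind_proper by auto
  fix U assume U: "gri U \<and> coind N \<subseteq> U \<and> U \<noteq> carrier R"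
  have "res U \<noteq> carrier E"
  proof
    assume full: "res U = carrier E"
    have "r \<in> U" if r: "r \<in> carrier R" for r
    proof (rule gri_homogeneousI[OF _ r])
      fix \<gamma> assume \<gamma>: "\<gamma> \<in> Garr (pair_groupoid I)"
      obtain v w where vw: "\<gamma> = (v, w)" "v \<in> I" "w \<in> I" using \<gamma> by (cases \<gamma>) (simp add: arr)
      have h: "hcomp \<gamma> r \<in> A (v, w)" using hcomp_in[OF r \<gamma>] vw by simp
      show "hcomp \<gamma> r \<in> U"
        using row_subset[OF _ full vw(3)] coind_off_row[OF Nr(1) vw(2,3) _ h] h U
        by (cases "v = x") auto
    qed (use U in blast)
    then show False using U gri_subset by blast
  qed
  moreover have "N \<subseteq> res U" using U res_mono res_coind[OF Nr(1)] by blast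
  ultimately have "res U = N"
    using N U res_right_ideal unfolding maximal_right_ideal_def by blast
  then show "U = coind N" using subset_coind_res U by blast
qed

section \<open>The radical of a corner ring\<close>

abbreviation "grad \<equiv> gr_radical (pair_groupoid I) R A"
abbreviation "jac \<equiv> jacobson_radical E"

lemma jac_right_ideal: "right_ideal E jac"
  by (rule right_ideal_jacobson_radical[OF E_ring])

text \<open>
  The two families of maximal ideals correspond to each other, except for those gr-maximal ideals
  that restrict to all of \<open>E\<close> and therefore impose no condition on the corner.
\<close>

lemma res_radical: "res grad = jac"
proof (intro equalityI subsetI)
  fix a assume a: "a \<in> res grad"
  then have ac: "a \<in> carrier E" "\<phi> a \<in> grad" by (auto simp: res_def)
  have "a \<in> N" if N: "maximal_right_ideal E N" for N
  proof -
    have "\<phi> a \<in> coind N" using ac coind_gr_maximal[OF N] by (auto simp: gr_radical_def)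
    then have "a \<in> res (coind N)" using ac by (simp add: res_def)
    then show ?thesis using res_coind N by (simp add: maximal_right_ideal_def)
  qed
  then show "a \<in> jac" using ac by (auto simp: jacobson_radical_def)
next
  fix a assume a: "a \<in> jac"
  then have ac: "a \<in> carrier E" by (simp add: jacobson_radical_def)
  have "a \<in> res M" if M: "gr_maximal (pair_groupoid I) R A M" for M
    using res_gr_maximal(1)[OF M] ac a by (auto simp: jacobson_radical_def)
  then show "a \<in> res grad" using ac \<phi>_carrier by (auto simp: res_def gr_radical_def)
qed

text \<open>
  A gr-maximal \<open>M\<close> contains row \<open>x\<close> or is of the form \<open>coind (res M)\<close> with \<open>res M\<close> maximal; in the
  second case it contains \<open>coind jac\<close>.
\<close>

lemma coind_jac_row:
  assumes "y \<in> I" "r \<in> A (x, y)" "r \<in> coind jac"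
  shows "r \<in> grad"
proof -
  have "r \<in> M" if M: "gr_maximal (pair_groupoid I) R A M" for M
  proof (cases "res M = carrier E")
    case True
    then show ?thesis using row_subset assms M by (simp add: gr_maximal_def)
  next
    case False
    have "jac \<subseteq> res M" using res_gr_maximal(1)[OF M False] by (auto simp: jacobson_radical_def)
    then show ?thesis using assms coind_mono res_gr_maximal(2)[OF M False] by blast
  qed
  then show ?thesis using assms by (auto simp: gr_radical_def coind_def)
qed

lemma radical_subset_coind: "grad \<subseteq> coind jac"
  using subset_coind_res[OF gr_radical_gri] res_radical by simp

lemma radical_subset_coind_above: "\<lbrakk>jac \<subseteq> V\<rbrakk> \<Longrightarrow> grad \<subseteq> coind V"
  using radical_subset_coind coind_mono by blast

section \<open>Minimal right ideals over the radicals\<close>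

text \<open>
  A right ideal \<open>V\<close> between \<^term>\<open>jac\<close> and \<open>res U\<close> is recovered as the restriction of \<open>U \<inter> coind V\<close>,
  to which the minimality of \<open>U\<close> applies.
\<close>

lemma res_minimal_over:
  assumes U: "gr_minimal_over (pair_groupoid I) R A grad U" and ne: "res U \<noteq> jac"
  shows "minimal_over E jac (res U)"
  unfolding minimal_over_def
proof (intro conjI allI impI ne)
  have Ug: "gri U" "grad \<subseteq> U" using U by (auto simp: gr_minimal_over_def)
  show "right_ideal E (res U)" using Ug res_right_ideal by blast
  show "jac \<subseteq> res U" using res_mono[OF Ug(2)] res_radical by simp
  fix V assume V: "right_ideal E V \<and> jac \<subseteq> V \<and> V \<subseteq> res U"
  have "gri (U \<inter> coind V)" "grad \<subseteq> U \<inter> coind V"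
    using gri_Int coind_gri radical_subset_coind_above V Ug by auto
  then have "U \<inter> coind V = grad \<or> U \<inter> coind V = U" using U unfolding gr_minimal_over_def by blast
  moreover have "res (U \<inter> coind V) = V"
    using res_coind[of V] V by (auto simp: res_def)
  ultimately show "V = jac \<or> V = res U" using res_radical by metis
qed

text \<open>
  The diagonal entry maps each summand \<open>U\<close> of \<open>R\<close> onto the copy of \<open>res U\<close>, and it fixes the
  corner, so the corner is the sum of the restrictions.
\<close>

theorem semilocal_corner:
  assumes "gr_semilocal (pair_groupoid I) R A"
  shows "semilocal_ring E"
proof -
  obtain F where F: "\<And>U. U \<in> F \<Longrightarrow> gr_minimal_over (pair_groupoid I) R A grad U"
    "carrier R = span R (grad \<union> \<Union>F)"
    using assms gr_semilocal_iff by auto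
  define F' where "F' = {res U | U. U \<in> F \<and> res U \<noteq> jac}"
  have F'_min: "\<forall>V\<in>F'. minimal_over E jac V" using F(1) res_minimal_over by (auto simp: F'_def)
  have Fg: "\<And>U. U \<in> F \<Longrightarrow> gri U" using F(1) by (simp add: gr_minimal_over_def)
  have sub: "jac \<union> \<Union>F' \<subseteq> carrier E"
    using right_ideal_subset[OF jac_right_ideal] by (auto simp: F'_def res_def)
  let ?S = "span E (jac \<union> \<Union>F')"
  have S: "additive_subgroup ?S E" using sub by (rule E.span_additive_subgroup)
  have Sim: "additive_subgroup (\<phi> ` ?S) R"
    by (rule additive_subgroup_image)
      (use S E.abelian_group_axioms abelian_group_axioms \<phi>_carrier \<phi>_add in auto)
  have res_S: "res U \<subseteq> ?S" if "U \<in> F \<or> U = grad" for U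
    using that res_radical unfolding F'_def by (auto intro!: generate.incl)
  have "a \<in> ?S" if a: "a \<in> carrier E" for a
  proof -
    have "diag (\<phi> a) \<in> \<phi> ` ?S"
    proof (rule span_map[of R diag _ "grad \<union> \<Union>F"])
      show "\<phi> a \<in> span R (grad \<union> \<Union>F)" using F(2) \<phi>_carrier[OF a] by simp
      show "grad \<union> \<Union>F \<subseteq> carrier R" using gri_subset[OF Fg] gri_subset[OF gr_radical_gri] by blast
    next
      fix b assume "b \<in> grad \<union> \<Union>F"
      then obtain U where U: "U \<in> F \<or> U = grad" "b \<in> U" by blast
      then have Ug: "gri U" using Fg gr_radical_gri by blast
      then have "diag b \<in> U" using U(2) by (intro gri_hcomp) (simp_all add: arr x)
      moreover obtain c where "c \<in> carrier E" "diag b = \<phi> c"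
        using \<phi>_surj[OF diag_grade] gri_subset[OF Ug] U(2) by blast
      ultimately show "diag b \<in> \<phi> ` ?S" using res_S[OF U(1)] by (auto simp: res_def)
    qed (use abelian_group_axioms hcomp_carrier hcomp_add Sim in \<open>auto simp: arr x\<close>)
    moreover have "diag (\<phi> a) = \<phi> a" using hcomp_homogeneous[OF _ \<phi>_grade[OF a]] x by (simp add: arr)
    ultimately show ?thesis using \<phi>_mem_image_iff[OF a additive_subgroup.a_subset[OF S]] by simp
  qed
  then have "carrier E = ?S" using additive_subgroup.a_subset[OF S] by blast
  then show ?thesis using semilocal_ring_iff[OF E_ring] F'_min by blast
qed

text \<open>
  This is \<open>J + V R\<close>, the smallest graded right ideal containing the radical and \<open>V\<close>. It is used in
  place of \<open>coind V\<close> because minimality needs a right ideal that is generated by the radical and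
  elements of the corner.
\<close>

definition gen :: "'e set \<Rightarrow> 'a set" where
  "gen V = span R (grad \<union> {\<phi> v \<otimes> r | v r. v \<in> V \<and> r \<in> carrier R})"

lemma gen_base_carrier:
  "V \<subseteq> carrier E \<Longrightarrow> grad \<union> {\<phi> v \<otimes> r | v r. v \<in> V \<and> r \<in> carrier R} \<subseteq> carrier R"
  using \<phi>_carrier m_closed gri_subset[OF gr_radical_gri] by auto

lemma gen_radical: "grad \<subseteq> gen V"
  unfolding gen_def by (intro subsetI generate.incl UnI1)

lemma gen_product: "\<lbrakk>v \<in> V; r \<in> carrier R\<rbrakk> \<Longrightarrow> \<phi> v \<otimes> r \<in> gen V"
  unfolding gen_def by (intro generate.incl UnI2) blast

lemma gen_gri:
  assumes V: "V \<subseteq> carrier E"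
  shows "gri (gen V)"
  unfolding gen_def
proof (rule gri_span[OF gen_base_carrier[OF V]], fold gen_def)
  fix s assume s: "s \<in> grad \<union> {\<phi> v \<otimes> r | v r. v \<in> V \<and> r \<in> carrier R}"
  show "s \<otimes> r \<in> gen V" if r: "r \<in> carrier R" for r
    using s
  proof
    assume "s \<in> grad" then show ?thesis using gri_mult[OF gr_radical_gri _ r] gen_radical by blast
  next
    assume "s \<in> {\<phi> v \<otimes> r | v r. v \<in> V \<and> r \<in> carrier R}"
    then obtain v t where "s = \<phi> v \<otimes> t" "v \<in> V" "t \<in> carrier R" by blast
    then show ?thesis using V r gen_product[of v V "t \<otimes> r"] \<phi>_carrier
      by (auto simp: m_assoc m_closed)
  qed
  show "hcomp \<gamma> s \<in> gen V" if \<gamma>: "\<gamma> \<in> Garr (pair_groupoid I)" for \<gamma>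
    using s
  proof
    assume "s \<in> grad" then show ?thesis using gri_hcomp[OF gr_radical_gri _ \<gamma>] gen_radical by blast
  next
    assume "s \<in> {\<phi> v \<otimes> r | v r. v \<in> V \<and> r \<in> carrier R}"
    then obtain v t where s: "s = \<phi> v \<otimes> t" "v \<in> V" "t \<in> carrier R" by blast
    then have "\<phi> v \<in> A (x, x)" using V \<phi>_grade by blast
    then have "hcomp \<gamma> s = \<zero> \<or> (\<exists>\<delta>\<in>Garr (pair_groupoid I). hcomp \<gamma> s = \<phi> v \<otimes> hcomp \<delta> t)"
      unfolding s(1) using \<gamma> s(3) x by (intro hcomp_left_image[of "(x, x)"]) (simp_all add: arr)
    then show ?thesis
      using gen_product[OF s(2) hcomp_carrier[OF s(3)]]
        subsetD[OF gen_radical gri_zero[OF gr_radical_gri]]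
      by auto
  qed
qed

lemma gen_subset_coind:
  assumes V: "right_ideal E V" "jac \<subseteq> V"
  shows "gen V \<subseteq> coind V"
  unfolding gen_def
proof (rule span_in_subgroup[OF gri_subgroup[OF coind_gri[OF V(1)]]])
  have "\<phi> v \<otimes> r \<in> coind V" if "v \<in> V" "r \<in> carrier R" for v r
  proof -
    have "\<phi> v \<in> coind V" using res_coind[OF V(1)] that by (auto simp: res_def)
    then show ?thesis using gri_mult[OF coind_gri[OF V(1)]] that by blast
  qed
  then show "grad \<union> {\<phi> v \<otimes> r | v r. v \<in> V \<and> r \<in> carrier R} \<subseteq> coind V"
    using radical_subset_coind_above[OF V(2)] by blast
qed

lemma res_gen:
  assumes V: "right_ideal E V" "jac \<subseteq> V"
  shows "res (gen V) = V"
proof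
  show "res (gen V) \<subseteq> V" using res_mono[OF gen_subset_coind[OF V]] res_coind[OF V(1)] by simp
  show "V \<subseteq> res (gen V)"
  proof
    fix v assume v: "v \<in> V"
    then have vc: "v \<in> carrier E" using right_ideal_subset V by blast
    have "\<phi> v \<otimes> \<phi> \<one>\<^bsub>E\<^esub> \<in> gen V" using v \<phi>_carrier by (intro gen_product) auto
    then show "v \<in> res (gen V)" using vc unit_right[OF x \<phi>_grade[OF vc]] by (simp add: res_def)
  qed
qed

text \<open>
  The products \<open>\<phi> v \<otimes> r\<close> lie in row \<open>x\<close>, so other rows of \<open>gen V\<close> come from the radical alone.
\<close>

lemma gen_off_row:
  assumes V: "V \<subseteq> carrier E" and g: "u \<in> I" "y \<in> I" "u \<noteq> x" and w: "w \<in> gen V"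
  shows "hcomp (u, y) w \<in> grad"
proof (rule span_map[of R "hcomp (u, y)"])
  show "w \<in> span R (grad \<union> {\<phi> v \<otimes> r | v r. v \<in> V \<and> r \<in> carrier R})"
    using w by (simp add: gen_def)
  show "grad \<union> {\<phi> v \<otimes> r | v r. v \<in> V \<and> r \<in> carrier R} \<subseteq> carrier R"
    by (rule gen_base_carrier[OF V])
next
  fix b assume "b \<in> grad \<union> {\<phi> v \<otimes> r | v r. v \<in> V \<and> r \<in> carrier R}"
  then show "hcomp (u, y) b \<in> grad"
  proof
    assume "b \<in> grad"
    then show ?thesis using g by (intro gri_hcomp[OF gr_radical_gri]) (simp_all add: arr)
  next
    assume "b \<in> {\<phi> v \<otimes> r | v r. v \<in> V \<and> r \<in> carrier R}"
    then obtain v r where b: "b = \<phi> v \<otimes> r" "v \<in> V" "r \<in> carrier R" by blast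
    have vx: "\<phi> v \<in> A (x, x)" using b V \<phi>_grade by blast
    have "hcomp (u, y) (\<phi> v \<otimes> r) = \<zero>"
      using b(3)
    proof (induction r rule: homogeneous_induct)
      case zero then show ?case using b V \<phi>_carrier by (auto simp: mult_zero_right hcomp_zero)
    next
      case (plus s t)
      then show ?case using b V \<phi>_carrier[of v] by (auto simp: r_distr m_closed hcomp_add)
    next
      case (base \<gamma> s)
      have xx: "(x, x) \<in> Garr (pair_groupoid I)" using x by (simp add: arr)
      obtain p q where \<gamma>: "\<gamma> = (p, q)" by (cases \<gamma>)
      then have pq: "p \<in> I" "q \<in> I" using base by (auto simp: arr)
      show ?case
      proof (cases "p = x")
        case True
        then have "\<phi> v \<otimes> s \<in> A (x, q)" using grade_mult[OF xx base(1) vx base(2)] \<gamma> by simp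
        then show ?thesis using hcomp_homogeneous[of "(x, q)"] g x pq by (simp add: arr)
      next
        case False
        then have "\<phi> v \<otimes> s = \<zero>" using grade_mult_zero[OF xx base(1) vx base(2)] \<gamma> by simp
        then show ?thesis by (simp add: hcomp_zero)
      qed
    qed
    then show ?thesis using b gri_zero[OF gr_radical_gri] by simp
  qed
qed (use abelian_group_axioms hcomp_add hcomp_carrier gri_subgroup[OF gr_radical_gri] g in
  \<open>auto simp: arr\<close>)

text \<open>
  Given \<open>W\<close> between \<open>J\<close> and \<open>J + V R\<close>, minimality of \<open>V\<close> leaves two values for \<open>res W\<close>. If it is the
  Jacobson radical, row \<open>x\<close> of \<open>W\<close> lies in \<open>J\<close> by \<open>coind_jac_row\<close>, and the other rows already do
  because \<open>V R\<close> lies in row \<open>x\<close>. If it is \<open>V\<close>, then \<open>W\<close> contains the generators of \<open>J + V R\<close>.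
\<close>

lemma gen_minimal_over:
  assumes V: "minimal_over E jac V"
  shows "gr_minimal_over (pair_groupoid I) R A grad (gen V)"
  unfolding gr_minimal_over_def
proof (intro conjI allI impI)
  have Vr: "right_ideal E V" "jac \<subseteq> V" "V \<noteq> jac" using V by (auto simp: minimal_over_def)
  note Vc = right_ideal_subset[OF Vr(1)]
  show "gri (gen V)" using Vc by (rule gen_gri)
  show "grad \<subseteq> gen V" by (rule gen_radical)
  show "gen V \<noteq> grad" using res_gen[OF Vr(1,2)] res_radical Vr(3) by auto
  fix W assume W: "gri W \<and> grad \<subseteq> W \<and> W \<subseteq> gen V"
  then have Wg: "gri W" by blast
  have "right_ideal E (res W)" "jac \<subseteq> res W" "res W \<subseteq> V"
    using res_right_ideal[OF Wg] res_mono[of grad W] res_mono[of W "gen V"] W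
      res_radical res_gen[OF Vr(1,2)] by auto
  then consider "res W = jac" | "res W = V" using V unfolding minimal_over_def by blast
  then show "W = grad \<or> W = gen V"
  proof cases
    case 1
    have "w \<in> grad" if w: "w \<in> W" for w
    proof (rule gri_homogeneousI[OF gr_radical_gri])
      show wc: "w \<in> carrier R" using w gri_subset[OF Wg] by blast
      fix \<gamma> assume \<gamma>: "\<gamma> \<in> Garr (pair_groupoid I)"
      obtain u y where uy: "\<gamma> = (u, y)" "u \<in> I" "y \<in> I" using \<gamma> by (cases \<gamma>) (simp add: arr)
      show "hcomp \<gamma> w \<in> grad"
      proof (cases "u = x")
        case True
        have "hcomp \<gamma> w \<in> coind jac"
          using subset_coind_res[OF Wg] 1 gri_hcomp[OF Wg w \<gamma>] by auto
        then show ?thesis using coind_jac_row[OF uy(3)] hcomp_in[OF wc \<gamma>] uy True by simp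
      next
        case False
        then show ?thesis using gen_off_row[OF Vc uy(2,3)] w W uy by auto
      qed
    qed
    then show ?thesis using W by blast
  next
    case 2
    have "\<phi> v \<otimes> r \<in> W" if "v \<in> V" "r \<in> carrier R" for v r
      using that 2 gri_mult[OF Wg] by (auto simp: res_def)
    then have "gen V \<subseteq> W"
      unfolding gen_def using W by (intro span_in_subgroup[OF gri_subgroup[OF Wg]]) blast
    then show ?thesis using W by blast
  qed
qed

text \<open>
  Multiplying a decomposition of the identity of \<open>E\<close> by an element \<open>r\<close> of row \<open>x\<close> decomposes \<open>r\<close>.
\<close>

theorem row_semisimple:
  assumes "semilocal_ring E"
  shows "\<exists>F. (\<forall>U\<in>F. gr_minimal_over (pair_groupoid I) R A grad U) \<and>
           (\<forall>y\<in>I. A (x, y) \<subseteq> span R (grad \<union> \<Union>F))"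
proof -
  obtain F where F: "\<And>V. V \<in> F \<Longrightarrow> minimal_over E jac V" "carrier E = span E (jac \<union> \<Union>F)"
    using assms semilocal_ring_iff[OF E_ring] by auto
  have Fr: "\<And>V. V \<in> F \<Longrightarrow> right_ideal E V" using F(1) by (simp add: minimal_over_def)
  have Fc: "jac \<union> \<Union>F \<subseteq> carrier E"
    using right_ideal_subset[OF jac_right_ideal] right_ideal_subset[OF Fr] by blast
  let ?B = "grad \<union> \<Union>(gen ` F)"
  have Bc: "?B \<subseteq> carrier R"
    using gri_subset[OF gr_radical_gri] gri_subset[OF gen_gri[OF right_ideal_subset[OF Fr]]] by blast
  have "r \<in> span R ?B" if y: "y \<in> I" and r: "r \<in> A (x, y)" for y r
  proof -
    have rc: "r \<in> carrier R" using grade_carrier y r x by (auto simp: arr)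
    have "\<phi> \<one>\<^bsub>E\<^esub> \<otimes> r \<in> span R ?B"
    proof (rule E.span_map[of R "\<lambda>a. \<phi> a \<otimes> r" _ "jac \<union> \<Union>F"])
      show "\<one>\<^bsub>E\<^esub> \<in> span E (jac \<union> \<Union>F)" using F(2) E.one_closed by simp
      show "additive_subgroup (span R ?B) R" by (rule span_additive_subgroup[OF Bc])
    next
      fix b assume "b \<in> jac \<union> \<Union>F"
      then have "\<phi> b \<otimes> r \<in> ?B"
      proof
        assume "b \<in> jac"
        then have "\<phi> b \<in> grad" using res_radical by (auto simp: res_def)
        then show ?thesis using gri_mult[OF gr_radical_gri _ rc] by blast
      next
        assume "b \<in> \<Union>F" then show ?thesis using gen_product rc by blast
      qed
      then show "\<phi> b \<otimes> r \<in> span R ?B" by (rule generate.incl)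
    qed (use abelian_group_axioms Fc rc \<phi>_carrier m_closed in \<open>auto simp: \<phi>_add l_distr\<close>)
    then show ?thesis using unit_left[OF y r] by simp
  qed
  then show ?thesis using gen_minimal_over F(1) by (intro exI[of _ "gen ` F"]) blast
qed

end

section \<open>Preadditive categories\<close>

context preadditive_category
begin

lemma homogeneous_add:
  assumes "X \<in> Obj C" "Y \<in> Obj C" "a \<in> carrier (Hom C Y X)" "b \<in> carrier (Hom C Y X)"
  shows "homogeneous C X Y (a \<otimes>\<^bsub>Hom C Y X\<^esub> b) =
           homogeneous C X Y a \<oplus>\<^bsub>category_ring C\<^esub> homogeneous C X Y b"
proof (rule cr_ext)
  interpret A: abelian_group "category_ring C" by (rule cr_abelian_group)
  interpret H: comm_group "Hom C Y X" using assms hom_group by blast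
  show "homogeneous C X Y (a \<otimes>\<^bsub>Hom C Y X\<^esub> b) \<in> carrier (category_ring C)"
    "homogeneous C X Y a \<oplus>\<^bsub>category_ring C\<^esub> homogeneous C X Y b \<in> carrier (category_ring C)"
    using assms by (auto intro!: homogeneous_carrier A.a_closed)
  fix V W assume VW: "V \<in> Obj C" "W \<in> Obj C"
  interpret K: comm_group "Hom C W V" using VW hom_group by blast
  show "homogeneous C X Y (a \<otimes>\<^bsub>Hom C Y X\<^esub> b) (V, W) =
      (homogeneous C X Y a \<oplus>\<^bsub>category_ring C\<^esub> homogeneous C X Y b) (V, W)"
    using VW by (simp add: homogeneous_app cr_add_app)
qed

lemma homogeneous_inj:
  assumes "X \<in> Obj C" "Y \<in> Obj C" "homogeneous C X Y a = homogeneous C X Y b"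
  shows "a = b"
  using fun_cong[OF assms(3), of "(X, Y)"] assms(1,2) by (simp add: homogeneous_app)

lemma end_ring_corner:
  assumes X: "X \<in> Obj C"
  shows "corner (Obj C) (category_ring C) (category_ring_grade C) (end_ring C X) X
    (homogeneous C X X)"
proof (intro corner.intro corner_axioms.intro category_ring_graded end_ring_is_ring X
    preadditive_category_axioms)
  show "bij_betw (homogeneous C X X) (carrier (end_ring C X)) (category_ring_grade C (X, X))"
    using X homogeneous_inj[OF X X]
    by (auto simp: bij_betw_def inj_on_def end_ring_def category_ring_grade_eq)
qed (use X in \<open>auto simp: end_ring_def homogeneous_add category_ring_grade_eq idn_closed idn_left
  idn_right category_ring_mult_homogeneous\<close>)

end

text \<open>
  A semilocal category restricts the endomorphism rings of nonzero objects only; the rows of the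
  other objects need no summand, because they vanish.
\<close>

lemma zero_object_row:
  assumes "preadditive_category C" "zero_object C X" "Y \<in> Obj C"
  shows "category_ring_grade C (X, Y) \<subseteq> {\<zero>\<^bsub>category_ring C\<^esub>}"
proof -
  interpret preadditive_category C by fact
  have X: "X \<in> Obj C" using assms(2) by (simp add: zero_object_def)
  show ?thesis
  proof
    fix r assume "r \<in> category_ring_grade C (X, Y)"
    then obtain f where f: "f \<in> carrier (Hom C Y X)" "r = homogeneous C X Y f"
      using X assms(3) by (auto simp: category_ring_grade_eq)
    have "f = \<one>\<^bsub>Hom C Y X\<^esub>"
      using assms(2,3) f(1) one_in[OF assms(3) X] unfolding zero_object_def by blast
    moreover have "homogeneous C X Y \<one>\<^bsub>Hom C Y X\<^esub> = \<zero>\<^bsub>category_ring C\<^esub>"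
      by (rule cr_ext)
        (use X assms(3) abelian_group.axioms(1)[OF cr_abelian_group] in
          \<open>auto simp: homogeneous_app cr_zero_app homogeneous_carrier one_in abelian_monoid.zero_closed\<close>)
    ultimately show "r \<in> {\<zero>\<^bsub>category_ring C\<^esub>}" using f by simp
  qed
qed

theorem corollary6p15:
  fixes C :: "('o, 'm) precat"
  assumes "preadditive_category C"
    and "has_nonzero_object C"
  shows "semilocal_category C \<longleftrightarrow>
           gr_semilocal (pair_groupoid (Obj C)) (category_ring C) (category_ring_grade C)"
proof
  assume "gr_semilocal (pair_groupoid (Obj C)) (category_ring C) (category_ring_grade C)"
  then show "semilocal_category C"
    using assms corner.semilocal_corner[OF preadditive_category.end_ring_corner[OF assms(1)]]
    by (simp add: semilocal_category_def)
next
  assume C: "semilocal_category C"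
  let ?R = "category_ring C" and ?A = "category_ring_grade C" and ?G = "pair_groupoid (Obj C)"
  interpret graded_ring ?G ?R ?A by (rule category_ring_graded[OF assms(1)])
  let ?J = "gr_radical ?G ?R ?A"
  have "\<exists>F. (\<forall>U\<in>F. gr_minimal_over ?G ?R ?A ?J U) \<and>
          (\<forall>Y\<in>Obj C. ?A (X, Y) \<subseteq> span ?R (?J \<union> \<Union>F))" if X: "X \<in> Obj C" for X
  proof (cases "zero_object C X")
    case True
    have "\<zero>\<^bsub>?R\<^esub> \<in> span ?R (?J \<union> \<Union>{})" using generate.one[of "add_monoid ?R"] by simp
    then show ?thesis using zero_object_row[OF assms(1) True] by (intro exI[of _ "{}"]) blast
  next
    case False
    then have "semilocal_ring (end_ring C X)" using C X by (simp add: semilocal_category_def)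
    then show ?thesis
      by (rule corner.row_semisimple[OF preadditive_category.end_ring_corner[OF assms(1) X]])
  qed
  then obtain F where F: "\<And>X. X \<in> Obj C \<Longrightarrow> (\<forall>U\<in>F X. gr_minimal_over ?G ?R ?A ?J U) \<and>
          (\<forall>Y\<in>Obj C. ?A (X, Y) \<subseteq> span ?R (?J \<union> \<Union>(F X)))"
    by metis
  let ?F = "\<Union>(F ` Obj C)"
  have min: "\<forall>U\<in>?F. gr_minimal_over ?G ?R ?A ?J U" using F by blast
  have sub: "?J \<union> \<Union>?F \<subseteq> carrier ?R"
  proof -
    have "U \<subseteq> carrier ?R" if "U \<in> ?F" for U
      using min that gri_subset[of U] unfolding gr_minimal_over_def by blast
    then show ?thesis using gri_subset[OF gr_radical_gri] by blast
  qed
  have S: "additive_subgroup (span ?R (?J \<union> \<Union>?F)) ?R" by (rule span_additive_subgroup[OF sub])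
  have "r \<in> span ?R (?J \<union> \<Union>?F)" if r: "r \<in> carrier ?R" for r
  proof (rule hcomp_recombine[OF S r])
    fix \<gamma> assume \<gamma>: "\<gamma> \<in> Garr ?G"
    then obtain X Y where XY: "\<gamma> = (X, Y)" "X \<in> Obj C" "Y \<in> Obj C" by (auto simp: pair_groupoid_def)
    have "hcomp \<gamma> r \<in> span ?R (?J \<union> \<Union>(F X))" using F[OF XY(2)] XY hcomp_in[OF r \<gamma>] by blast
    moreover have "span ?R (?J \<union> \<Union>(F X)) \<subseteq> span ?R (?J \<union> \<Union>?F)"
      using XY(2) by (intro add.mono_generate) blast
    ultimately show "hcomp \<gamma> r \<in> span ?R (?J \<union> \<Union>?F)" by blast
  qed
  then have "carrier ?R = span ?R (?J \<union> \<Union>?F)" using additive_subgroup.a_subset[OF S] by blast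
  then show "gr_semilocal ?G ?R ?A" unfolding gr_semilocal_iff using min by blast
qed

end
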